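(* Let $\tau>0$, $s\in\{1,\dots,m\}$, $0<\epsilon<1$, $0<\delta\le\sqrt2-1$. Suppose that $\psi_1,\dots,\psi_m$ are orthonormal functions in $L^2_\rho(\mathbb{X})$ and that there exists a constant $B\ge1$ such that $\|\psi_j\|_\infty\le B$ for all $j\in\{1,\dots,m\}$. Let $$L(s)=\log(2B^2s)\left[\log(2B^2s)\cdot\log(2m)+\log\left(2\epsilon^{-1}\log(2B^2s)\right)\right].$$ There exists a universal constant $C>0$ such that for all $n\ge C\cdot\delta^{-2}\cdot B^2\cdot s\cdot L(s)$ the following holds. Let $\{\mathbf{x}_t^{(i)}\}_{i=1}^n$ be $n$ data points sampled i.i.d. from $\rho$ and $\mathbf{y}_t^{(i)}=\mathbf{x}_{t+\tau}^{(i)}$. Suppose $K_m^\tau\in\mathbb{C}^{l\times m}$ satisfies $\Phi_n^\tau=K_m^\tau\Psi_n+E$, where $E\in\mathbb{C}^{l\times n}$ is a matrix of errors with $\|E\|_F\le\eta$ for some $\eta>0$. Take $\lambda\in(c_1\eta/\sqrt s,\ c_2\eta/\sqrt s)$ for $c_2\ge c_1>0$. Let $(K_{mn}^\tau)^\#$ be the solution of the LASSO-EDMD problem $$\min_{K\in\mathbb{C}^{l\times m}}\|\Phi_n^\tau-K\Psi_n\|_F^2+\lambda\|K\|_{F,1}.$$ Then, with probability greater than $1-\epsilon$, there exist constants $C_1,D_1>0$ such that $$\bigl\|(K_{mn}^\tau)^\#-K_m^\tau\bigr\|_F^2\le\sum_{i=1}^l\left[C_1\frac{\sigma_s(\mathbf{k}_{m,i})}{\sqrt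 s}+D_1\eta\right]^2,$$ where $\mathbf{k}_{m,i}\in\mathbb{C}^m$ is the $i$th column of $(K_m^\tau)^*$.
   Context: Let $\mathbb{X}\subseteq\mathbb{R}^d$ be the state space of a dynamical system with states $\mathbf{x}_t$, and let $\rho$ be a probability measure on $\mathbb{X}$. Data are pairs $(\mathbf{x}_t^{(i)},\mathbf{y}_t^{(i)})$, $i=1,\dots,n$, where the $\mathbf{x}_t^{(i)}$ are i.i.d. with law $\rho$ and $\mathbf{y}_t^{(i)}=\mathbf{x}_{t+\tau}^{(i)}$ is the state reached from $\mathbf{x}_t^{(i)}$ after time $\tau$. Let $\vec\psi=(\psi_1,\dots,\psi_m)$ and $\vec\phi=(\phi_1,\dots,\phi_l)$ be dictionaries of possibly complex-valued functions in $L^2_\rho(\mathbb{X})$. Set $\Psi_n=(\psi_i(\mathbf{x}_t^{(j)}))_{i,j}\in\mathbb{C}^{m\times n}$ and $\Phi_n^\tau=(\phi_i(\mathbf{y}_t^{(j)}))_{i,j}\in\mathbb{C}^{l\times n}$. The Koopman operator is $\mathcal{K}^\tau[\varphi](\mathbf{x})=\mathbb{E}[\varphi(\mathbf{x}_{t+\tau})\mid\mathbf{x}_t=\mathbf{x}]$, and $K_m^\tau$ denotes the matrix representing its projection in $L^2_\rho(\mathbb{X})$ onto $\mathrm{span}\{\psi_1,\dots,\psi_m\}$: $\sum_{i=1}^m(K_m^\tau)_{ji}\psi_i$ is the projection of $\mathcal{K}^\tau[\phi_j]$. EDMD stands for Extended Dynamic Mode Decomposition. $\|\cdot\|_F$ is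 the Frobenius norm, $\|A\|_{F,1}=\sum_{i,j}|A_{ij}|$ is the entrywise $\ell_1$-norm, and $A^*$ is the conjugate transpose. The $\ell_1$ best $s$-term approximation error of a vector $\mathbf{c}$ is $\sigma_s(\mathbf{c})=\min_{\|\mathbf{z}\|_0\le s}\|\mathbf{c}-\mathbf{z}\|_1$, where $\|\mathbf{z}\|_0$ is the number of nonzero entries of $\mathbf{z}$. *)

theory Defs
  imports
    "HOL-Probability.Probability"
    "HOL-Probability.Essential_Supremum"
    "Jordan_Normal_Form.Schur_Decomposition"
begin

text \<open>
  A point of Euclidean \<open>d\<close>-space is an extensional function on \<open>{..<d}\<close>, so that \<open>d\<close> is an
  ordinary variable and can be quantified inside a formula.
\<close>

type_synonym point = "nat \<Rightarrow> real"

definition state_space :: "nat \<Rightarrow> point set \<Rightarrow> point measure" where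
  "state_space d X = restrict_space (\<Pi>\<^sub>M k\<in>{..<d}. borel) X"

section \<open>Square-integrable functions\<close>

definition sq_integrable :: "'a measure \<Rightarrow> ('a \<Rightarrow> complex) \<Rightarrow> bool" where
  "sq_integrable \<rho> f \<longleftrightarrow> f \<in> borel_measurable \<rho> \<and> integrable \<rho> (\<lambda>x. (cmod (f x))\<^sup>2)"

definition L2_inner :: "'a measure \<Rightarrow> ('a \<Rightarrow> complex) \<Rightarrow> ('a \<Rightarrow> complex) \<Rightarrow> complex" where
  "L2_inner \<rho> f g = (LINT x|\<rho>. f x * cnj (g x))"

definition L2_orthonormal :: "'a measure \<Rightarrow> nat \<Rightarrow> (nat \<Rightarrow> 'a \<Rightarrow> complex) \<Rightarrow> bool" where
  "L2_orthonormal \<rho> m \<psi> \<longleftrightarrow>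
     (\<forall>i<m. sq_integrable \<rho> (\<psi> i)) \<and>
     (\<forall>i<m. \<forall>j<m. L2_inner \<rho> (\<psi> i) (\<psi> j) = (if i = j then 1 else 0))"

definition fun_span :: "nat \<Rightarrow> (nat \<Rightarrow> 'a \<Rightarrow> complex) \<Rightarrow> ('a \<Rightarrow> complex) set" where
  "fun_span m \<psi> = {(\<lambda>x. \<Sum>i<m. c i * \<psi> i x) | c. True}"

definition is_L2_projection ::
    "'a measure \<Rightarrow> ('a \<Rightarrow> complex) set \<Rightarrow> ('a \<Rightarrow> complex) \<Rightarrow> ('a \<Rightarrow> complex) \<Rightarrow> bool" where
  "is_L2_projection \<rho> V f p \<longleftrightarrow>
     sq_integrable \<rho> f \<and> p \<in> V \<and> (\<forall>v\<in>V. L2_inner \<rho> (\<lambda>x. f x - p x) v = 0)"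

section \<open>The Koopman operator\<close>

text \<open>
  The dynamics enter through the transition laws: \<open>\<kappa> \<tau> x\<close> is the conditional law of the state at
  time \<open>t + \<tau>\<close> given that the state at time \<open>t\<close> is \<open>x\<close>. Deterministic dynamics are the case of
  Dirac measures.
\<close>

definition koopman ::
    "(real \<Rightarrow> 'a \<Rightarrow> 'a measure) \<Rightarrow> real \<Rightarrow> ('a \<Rightarrow> complex) \<Rightarrow> 'a \<Rightarrow> complex" where
  "koopman \<kappa> \<tau> \<phi> x = (LINT y|\<kappa> \<tau> x. \<phi> y)"

text \<open>
  The integrability clause excludes points at which the Bochner integral defining the conditional
  expectation is only a default value.
\<close>

definition is_koopman_matrix ::
    "'a measure \<Rightarrow> (real \<Rightarrow> 'a \<Rightarrow> 'a measure) \<Rightarrow> real \<Rightarrow> nat \<Rightarrow> (nat \<Rightarrow> 'a \<Rightarrow> complex) \<Rightarrow>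
     nat \<Rightarrow> (nat \<Rightarrow> 'a \<Rightarrow> complex) \<Rightarrow> complex mat \<Rightarrow> bool" where
  "is_koopman_matrix \<rho> \<kappa> \<tau> m \<psi> l \<phi> K \<longleftrightarrow>
     K \<in> carrier_mat l m \<and>
     (\<forall>j<l. (AE x in \<rho>. integrable (\<kappa> \<tau> x) (\<phi> j)) \<and>
            is_L2_projection \<rho> (fun_span m \<psi>) (koopman \<kappa> \<tau> (\<phi> j))
              (\<lambda>x. \<Sum>i<m. K $$ (j, i) * \<psi> i x))"

section \<open>Data\<close>

text \<open>
  The initial states \<open>x i\<close> are independent with law \<open>\<rho>\<close>, and \<open>y i\<close> is the state reached from
  \<open>x i\<close> after time \<open>\<tau>\<close>, i.e. it is distributed according to \<open>\<kappa> \<tau> (x i)\<close> given \<open>x i\<close>.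
\<close>

definition koopman_data ::
    "'a measure \<Rightarrow> 'a measure \<Rightarrow> (real \<Rightarrow> 'a \<Rightarrow> 'a measure) \<Rightarrow> real \<Rightarrow>
     'w measure \<Rightarrow> nat \<Rightarrow> (nat \<Rightarrow> 'w \<Rightarrow> 'a) \<Rightarrow> (nat \<Rightarrow> 'w \<Rightarrow> 'a) \<Rightarrow> bool" where
  "koopman_data S \<rho> \<kappa> \<tau> M n x y \<longleftrightarrow>
     prob_space.indep_vars M (\<lambda>_. S) x {..<n} \<and>
     (\<forall>i<n. x i \<in> M \<rightarrow>\<^sub>M S \<and> y i \<in> M \<rightarrow>\<^sub>M S \<and>
        distr M S (x i) = \<rho> \<and>
        distr M (S \<Otimes>\<^sub>M S) (\<lambda>\<omega>. (x i \<omega>, y i \<omega>)) =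
          do {u \<leftarrow> \<rho>; v \<leftarrow> \<kappa> \<tau> u; return (S \<Otimes>\<^sub>M S) (u, v)})"

definition data_matrix ::
    "nat \<Rightarrow> nat \<Rightarrow> (nat \<Rightarrow> 'a \<Rightarrow> complex) \<Rightarrow> (nat \<Rightarrow> 'a) \<Rightarrow> complex mat" where
  "data_matrix m n \<psi> z = mat m n (\<lambda>(i, j). \<psi> i (z j))"

section \<open>Norms, best approximation and the LASSO\<close>

definition frob_norm :: "complex mat \<Rightarrow> real" where
  "frob_norm A = sqrt (\<Sum>i<dim_row A. \<Sum>j<dim_col A. (cmod (A $$ (i, j)))\<^sup>2)"

definition entry_l1_norm :: "complex mat \<Rightarrow> real" where
  "entry_l1_norm A = (\<Sum>i<dim_row A. \<Sum>j<dim_col A. cmod (A $$ (i, j)))"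

definition vec_l1_norm :: "complex Matrix.vec \<Rightarrow> real" where
  "vec_l1_norm v = (\<Sum>i<dim_vec v. cmod (vec_index v i))"

definition nnz :: "complex Matrix.vec \<Rightarrow> nat" where
  "nnz v = card {i. i < dim_vec v \<and> vec_index v i \<noteq> 0}"

text \<open>The infimum is attained, by a vector keeping \<open>s\<close> entries of \<open>c\<close> of largest modulus.\<close>

definition best_approx_error :: "nat \<Rightarrow> complex Matrix.vec \<Rightarrow> real" where
  "best_approx_error s c =
     (INF z \<in> {z \<in> carrier_vec (dim_vec c). nnz z \<le> s}. vec_l1_norm (c - z))"

definition is_lasso_edmd_solution ::
    "nat \<Rightarrow> nat \<Rightarrow> complex mat \<Rightarrow> complex mat \<Rightarrow> real \<Rightarrow> complex mat \<Rightarrow> bool" where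
  "is_lasso_edmd_solution l m \<Phi> \<Psi> lam K \<longleftrightarrow>
     is_arg_min (\<lambda>K. (frob_norm (\<Phi> - K * \<Psi>))\<^sup>2 + lam * entry_l1_norm K)
       (\<lambda>K. K \<in> carrier_mat l m) K"

definition L_factor :: "real \<Rightarrow> nat \<Rightarrow> real \<Rightarrow> nat \<Rightarrow> real" where
  "L_factor B m \<epsilon> s =
     (let a = ln (2 * B\<^sup>2 * real s)
      in a * (a * ln (2 * real m) + ln (2 * inverse \<epsilon> * a)))"

text \<open>
  Sample spaces are taken of one fixed type, so that a constant chosen before the sample space does
  not depend on a type variable. Any joint law of the data \<open>(x i, y i)\<close> for \<open>i < n\<close> can be realised
  on this type, through the coordinate projections.
\<close>

type_synonym sample = "nat \<Rightarrow> point \<times> point"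

end

theory Submission
  imports Defs
begin

text \<open>
  The restricted isometry property is not needed, only a lower bound on the cone of effectively
  sparse vectors: with high probability every \<open>h\<close> satisfies
  \<open>\<parallel>h\<parallel>\<^sub>2 \<le> \<parallel>h\<parallel>\<^sub>1 / (4 \<surd>s) + 8 \<parallel>h \<Psi>\<parallel>\<^sub>2\<close>. This is weaker than a restricted eigenvalue bound by a factor
  \<open>\<surd>n\<close>, since \<open>\<Psi>\<close> is not normalised, so one large value of \<open>f = \<Sum>\<^sub>j h\<^sub>j \<psi>\<^sub>j\<close> on the sample is enough.

  Let \<open>\<parallel>h\<parallel>\<^sub>2 = 1\<close>, \<open>\<parallel>h\<parallel>\<^sub>1 \<le> 4 \<surd>s\<close> and \<open>R = 4 B \<surd>s\<close>, so that \<open>f\<close> has norm 1 and is bounded by \<open>R\<close>. By the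
  pigeonhole principle one of the about \<open>log R\<close> dyadic levels \<open>u\<close> has \<open>P(\<bar>f\<bar> \<ge> u)\<close> of order at least
  \<open>1 / (u\<^sup>2 log R)\<close>. The empirical method of Maurey approximates \<open>f\<close> up to \<open>u / 4\<close>, off a small exceptional
  set, by a mean of about \<open>(R / u)\<^sup>2 log R\<close> multiples of the \<open>\<psi>\<^sub>j\<close>, hence by an element of a finite net
  with about \<open>m\<close> to the power \<open>(R / u)\<^sup>2 log R\<close> elements. A Chernoff bound for each element and a
  union bound show that, with high probability, each element of the net that is often large under \<open>\<rho>\<close> is
  often large on the sample.

  The LASSO objective splits into the rows of the matrix, and on each row the usual comparison of the
  minimiser with the true coefficients turns the lower bound into the error estimate.
\<close>

section \<open>Sparse approximation by random sampling\<close>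

lemma exp_le_quadratic:
  fixes x :: real
  assumes "\<bar>x\<bar> \<le> 1"
  shows "exp x \<le> 1 + x + x\<^sup>2"
proof (cases "0 \<le> x")
  case True
  then show ?thesis using exp_bound[of x] assms by simp
next
  case False
  define y where "y = - x"
  have y: "0 \<le> y" using False by (simp add: y_def)
  \<comment> \<open>The product exceeds 1 by \<open>y\<^sup>2 / 2 + y ^ 3 / 2 + y ^ 4 / 2\<close>,
    so \<open>1 - y + y\<^sup>2\<close> dominates the reciprocal of the Taylor polynomial of
    \<open>exp y\<close>, which dominates \<open>exp (- y)\<close>.\<close>
  have "1 \<le> (1 - y + y\<^sup>2) * (1 + y + y\<^sup>2 / 2)"
  proof -
    have "(1 - y + y\<^sup>2) * (1 + y + y\<^sup>2 / 2) = 1 + y\<^sup>2 / 2 + y ^ 3 / 2 + y ^ 4 / 2"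
      by (simp add: field_simps power2_eq_square power3_eq_cube power4_eq_xxxx)
    then show ?thesis using y by simp
  qed
  also have "\<dots> \<le> (1 - y + y\<^sup>2) * exp y"
  proof (rule mult_left_mono)
    show "0 \<le> 1 - y + y\<^sup>2" using assms by (simp add: y_def)
  qed (use exp_lower_Taylor_quadratic[OF y] in simp)
  finally have "exp (- y) \<le> 1 - y + y\<^sup>2"
    by (simp add: exp_minus field_simps)
  then show ?thesis by (simp add: y_def)
qed

text \<open>Chernoff's method for \<open>k\<close> independent draws from the weights \<open>p\<close>; the draws are the
  functions \<open>J\<close>, with the product weight.\<close>

lemma sampling_upper_tail:
  fixes p X :: "'a \<Rightarrow> real"
  assumes A: "finite A" and p: "\<And>a. a \<in> A \<Longrightarrow> 0 \<le> p a" "sum p A = 1"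
    and mean: "(\<Sum>a\<in>A. p a * X a) = 0" and X: "\<And>a. a \<in> A \<Longrightarrow> \<bar>X a\<bar> \<le> b"
    and t: "0 < t" "t \<le> 2 * b"
  shows "(\<Sum>J\<in>({..<k} \<rightarrow>\<^sub>E A). (\<Prod>l<k. p (J l)) * of_bool (real k * t \<le> (\<Sum>l<k. X (J l))))
           \<le> exp (- real k * t\<^sup>2 / (4 * b\<^sup>2))"
proof -
  have b: "0 < b" using t by linarith
  \<comment> \<open>This value minimises \<open>\<mu>\<^sup>2 * b\<^sup>2 - \<mu> * t\<close>, the
    exponent per draw. The condition \<open>t \<le> 2 * b\<close> keeps \<open>\<mu> * b\<close> at
    most 1, where the quadratic bound on \<open>exp\<close> applies.\<close>
  define \<mu> where "\<mu> = t / (2 * b\<^sup>2)"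
  have \<mu>: "0 \<le> \<mu>" using t b by (simp add: \<mu>_def)
  have \<mu>b: "\<mu> * b \<le> 1" using t b by (simp add: \<mu>_def power2_eq_square field_simps)
  have step: "(\<Sum>a\<in>A. p a * exp (\<mu> * X a)) \<le> exp (\<mu>\<^sup>2 * b\<^sup>2)"
  proof -
    have "(\<Sum>a\<in>A. p a * exp (\<mu> * X a)) \<le> (\<Sum>a\<in>A. p a * (1 + \<mu> * X a + \<mu>\<^sup>2 * b\<^sup>2))"
    proof (intro sum_mono mult_left_mono)
      fix a assume a: "a \<in> A"
      have abs: "\<bar>\<mu> * X a\<bar> \<le> \<mu> * b" using X[OF a] \<mu> by (simp add: abs_mult mult_left_mono)
      then have "(\<mu> * X a)\<^sup>2 \<le> (\<mu> * b)\<^sup>2" using abs_le_square_iff[of "\<mu> * X a" "\<mu> * b"] by linarith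
      then show "exp (\<mu> * X a) \<le> 1 + \<mu> * X a + \<mu>\<^sup>2 * b\<^sup>2"
        using exp_le_quadratic[of "\<mu> * X a"] abs \<mu>b by (simp add: power_mult_distrib)
    qed (use p in auto)
    also have "\<dots> = sum p A + \<mu> * (\<Sum>a\<in>A. p a * X a) + \<mu>\<^sup>2 * b\<^sup>2 * sum p A"
      by (simp add: distrib_left sum.distrib sum_distrib_left sum_distrib_right mult_ac)
    also have "\<dots> \<le> exp (\<mu>\<^sup>2 * b\<^sup>2)"
      using p(2) mean exp_ge_add_one_self[of "\<mu>\<^sup>2 * b\<^sup>2"] by simp
    finally show ?thesis .
  qed
  have "(\<Sum>J\<in>({..<k} \<rightarrow>\<^sub>E A). (\<Prod>l<k. p (J l)) * of_bool (real k * t \<le> (\<Sum>l<k. X (J l))))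
      \<le> (\<Sum>J\<in>({..<k} \<rightarrow>\<^sub>E A). exp (- \<mu> * real k * t) * (\<Prod>l<k. p (J l) * exp (\<mu> * X (J l))))"
  proof (rule sum_mono)
    fix J assume J: "J \<in> {..<k} \<rightarrow>\<^sub>E A"
    have pos: "0 \<le> (\<Prod>l<k. p (J l))" using J p by (intro prod_nonneg) auto
    have "of_bool (real k * t \<le> (\<Sum>l<k. X (J l))) \<le> exp (\<mu> * ((\<Sum>l<k. X (J l)) - real k * t))"
      using \<mu> by auto
    also have "\<dots> = exp (- \<mu> * real k * t) * (\<Prod>l<k. exp (\<mu> * X (J l)))"
      by (simp add: exp_sum[symmetric] exp_add[symmetric] sum_distrib_left algebra_simps)
    finally have "of_bool (real k * t \<le> (\<Sum>l<k. X (J l)))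
        \<le> exp (- \<mu> * real k * t) * (\<Prod>l<k. exp (\<mu> * X (J l)))" .
    from mult_left_mono[OF this pos]
    show "(\<Prod>l<k. p (J l)) * of_bool (real k * t \<le> (\<Sum>l<k. X (J l)))
        \<le> exp (- \<mu> * real k * t) * (\<Prod>l<k. p (J l) * exp (\<mu> * X (J l)))"
      by (simp only: prod.distrib mult_ac)
  qed
  also have "\<dots> = exp (- \<mu> * real k * t) * (\<Sum>a\<in>A. p a * exp (\<mu> * X a)) ^ k"
    using prod_sum_PiE[of "{..<k}" "\<lambda>_. A" "\<lambda>_ a. p a * exp (\<mu> * X a)"] A
    by (simp add: sum_distrib_left)
  also have "\<dots> \<le> exp (- \<mu> * real k * t) * exp (\<mu>\<^sup>2 * b\<^sup>2) ^ k"
    using step p by (intro mult_left_mono power_mono sum_nonneg) auto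
  also have "\<dots> = exp (- real k * t\<^sup>2 / (4 * b\<^sup>2))"
  proof -
    have "- \<mu> * real k * t + real k * (\<mu>\<^sup>2 * b\<^sup>2) = - real k * t\<^sup>2 / (4 * b\<^sup>2)"
      using b by (simp add: \<mu>_def field_simps power2_eq_square)
    then show ?thesis by (simp add: exp_of_nat_mult[symmetric] exp_add[symmetric])
  qed
  finally show ?thesis .
qed

text \<open>If \<open>cmod D\<close> is at least \<open>t\<close>, then the real part of
  \<open>z * D\<close> is at least \<open>t / 2\<close> for one of the four phases \<open>z\<close>,
  so four one-sided tails suffice. The centred terms are bounded by \<open>2 * c\<close>, and
  deviation \<open>t / 2\<close> against that bound gives the 64.\<close>

lemma sampling_deviation:
  fixes p :: "'a \<Rightarrow> real" and v :: "'a \<Rightarrow> complex"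
  assumes A: "finite A" and p: "\<And>a. a \<in> A \<Longrightarrow> 0 \<le> p a" "sum p A = 1"
    and v: "\<And>a. a \<in> A \<Longrightarrow> cmod (v a) \<le> c" and t: "0 < t" "t \<le> c" and k: "0 < k"
  shows "(\<Sum>J\<in>({..<k} \<rightarrow>\<^sub>E A). (\<Prod>l<k. p (J l)) *
            of_bool (t \<le> cmod ((\<Sum>l<k. v (J l)) / of_nat k - (\<Sum>a\<in>A. p a * v a))))
           \<le> 4 * exp (- real k * t\<^sup>2 / (64 * c\<^sup>2))"
proof -
  define f where "f = (\<Sum>a\<in>A. complex_of_real (p a) * v a)"
  have f: "cmod f \<le> c"
  proof -
    have "cmod f \<le> (\<Sum>a\<in>A. p a * c)"
      unfolding f_def using p v by (intro sum_norm_le) (auto simp: norm_mult intro!: mult_left_mono)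
    then show ?thesis using p by (simp add: sum_distrib_right[symmetric])
  qed
  define X where "X = (\<lambda>z a. Re (z * (v a - f)))"
  have tail: "(\<Sum>J\<in>({..<k} \<rightarrow>\<^sub>E A). (\<Prod>l<k. p (J l)) * of_bool (real k * (t / 2) \<le> (\<Sum>l<k. X z (J l))))
      \<le> exp (- real k * t\<^sup>2 / (64 * c\<^sup>2))" if z: "cmod z = 1" for z
  proof -
    have "(\<Sum>a\<in>A. p a * X z a) = Re (\<Sum>a\<in>A. p a * (z * (v a - f)))"
      by (simp add: X_def)
    also have "(\<Sum>a\<in>A. p a * (z * (v a - f))) = (\<Sum>a\<in>A. z * (p a * v a) - z * f * p a)"
      by (simp add: algebra_simps)
    also have "\<dots> = z * (f - f * of_real (sum p A))"
      by (simp add: sum_subtractf sum_distrib_left[symmetric] f_def[symmetric]) (simp add: algebra_simps)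
    finally have mean: "(\<Sum>a\<in>A. p a * X z a) = 0" using p by simp
    have bd: "\<bar>X z a\<bar> \<le> 2 * c" if "a \<in> A" for a
    proof -
      have "\<bar>X z a\<bar> \<le> cmod (v a - f)"
        unfolding X_def using abs_Re_le_cmod[of "z * (v a - f)"] z by (simp add: norm_mult)
      also have "\<dots> \<le> 2 * c" using norm_triangle_ineq4[of "v a" f] v[OF that] f by linarith
      finally show ?thesis .
    qed
    have "- real k * (t / 2)\<^sup>2 / (4 * (2 * c)\<^sup>2) = - real k * t\<^sup>2 / (64 * c\<^sup>2)"
      by (simp add: power_divide power_mult_distrib)
    then show ?thesis
      using sampling_upper_tail[OF A p mean bd, of "t / 2" k] t by auto
  qed
  have four: "(\<Sum>z\<in>{1, -1, \<i>, -\<i>}. g z) = g 1 + g (-1) + g \<i> + g (-\<i>)" for g :: "complex \<Rightarrow> real"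
    by (simp add: complex_eq_iff)
  have "(\<Sum>J\<in>({..<k} \<rightarrow>\<^sub>E A). (\<Prod>l<k. p (J l)) *
            of_bool (t \<le> cmod ((\<Sum>l<k. v (J l)) / of_nat k - f)))
      \<le> (\<Sum>J\<in>({..<k} \<rightarrow>\<^sub>E A). \<Sum>z\<in>{1, -1, \<i>, -\<i>}. (\<Prod>l<k. p (J l)) *
            of_bool (real k * (t / 2) \<le> (\<Sum>l<k. X z (J l))))"
  proof (rule sum_mono)
    fix J assume J: "J \<in> {..<k} \<rightarrow>\<^sub>E A"
    have pos: "0 \<le> (\<Prod>l<k. p (J l))" using J p by (intro prod_nonneg) auto
    define D where "D = (\<Sum>l<k. v (J l)) / of_nat k - f"
    have XD: "(\<Sum>l<k. X z (J l)) = real k * Re (z * D)" for z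
    proof -
      have "(\<Sum>l<k. X z (J l)) = Re (\<Sum>l<k. z * (v (J l) - f))"
        unfolding X_def Re_sum ..
      also have "(\<Sum>l<k. z * (v (J l) - f)) = z * (\<Sum>l<k. v (J l) - f)"
        by (rule sum_distrib_left[symmetric])
      also have "(\<Sum>l<k. v (J l) - f) = of_nat k * D"
        using k by (simp add: D_def sum_subtractf field_simps)
      also have "z * (of_nat k * D) = of_nat k * (z * D)" by simp
      also have "Re (of_nat k * (z * D)) = real k * Re (z * D)" by (simp only: times_complex.sel) simp
      finally show ?thesis .
    qed
    have iff: "real k * (t / 2) \<le> (\<Sum>l<k. X z (J l)) \<longleftrightarrow> t / 2 \<le> Re (z * D)" for z
      unfolding XD using k by (simp add: mult_le_cancel_left_pos del: times_divide_eq_right)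
    have "t / 2 \<le> Re D \<or> t / 2 \<le> - Re D \<or> t / 2 \<le> Im D \<or> t / 2 \<le> - Im D" if "t \<le> cmod D"
      using cmod_le[of D] that by linarith
    then have "of_bool (t \<le> cmod D) \<le> (\<Sum>z\<in>{1, -1, \<i>, -\<i>}. of_bool (real k * (t / 2) \<le> (\<Sum>l<k. X z (J l))) :: real)"
      unfolding iff four by auto
    from mult_left_mono[OF this pos]
    show "(\<Prod>l<k. p (J l)) * of_bool (t \<le> cmod ((\<Sum>l<k. v (J l)) / of_nat k - f)) \<le>
       (\<Sum>z\<in>{1, -1, \<i>, -\<i>}. (\<Prod>l<k. p (J l)) * of_bool (real k * (t / 2) \<le> (\<Sum>l<k. X z (J l))))"
      by (simp only: D_def sum_distrib_left[symmetric])
  qed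
  also have "\<dots> = (\<Sum>z\<in>{1, -1, \<i>, -\<i>}. \<Sum>J\<in>({..<k} \<rightarrow>\<^sub>E A). (\<Prod>l<k. p (J l)) *
            of_bool (real k * (t / 2) \<le> (\<Sum>l<k. X z (J l))))"
    by (rule sum.swap)
  also have "\<dots> \<le> (\<Sum>z\<in>{1, -1, \<i>, -\<i>}. exp (- real k * t\<^sup>2 / (64 * c\<^sup>2)))"
    by (intro sum_mono tail) auto
  also have "\<dots> = 4 * exp (- real k * t\<^sup>2 / (64 * c\<^sup>2))"
    by (simp only: four)
  finally show ?thesis by (simp add: f_def)
qed

lemma exists_le_weighted_mean:
  fixes w F :: "'a \<Rightarrow> real"
  assumes A: "finite A" and w: "\<And>a. a \<in> A \<Longrightarrow> 0 \<le> w a" "sum w A = 1"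
    and le: "(\<Sum>a\<in>A. w a * F a) \<le> C"
  shows "\<exists>a\<in>A. F a \<le> C"
proof (rule ccontr)
  assume "\<not> ?thesis"
  then have F: "C < F a" if "a \<in> A" for a using that by force
  obtain b where b: "b \<in> A" "w b \<noteq> 0"
    using w(2) by (metis sum.neutral zero_neq_one)
  have "(\<Sum>a\<in>A. w a * C) < (\<Sum>a\<in>A. w a * F a)"
  proof (rule sum_strict_mono_ex1)
    show "\<forall>a\<in>A. w a * C \<le> w a * F a" using w(1) mult_left_mono[OF less_imp_le[OF F]] by blast
    show "\<exists>a\<in>A. w a * C < w a * F a"
      using b F[of b] w(1)[of b] by (intro bexI[of _ b] mult_strict_left_mono) auto
  qed (use A in simp)
  then show False using le w(2) by (simp add: sum_distrib_right[symmetric])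
qed

text \<open>The empirical method of Maurey, applied to \<open>\<rho>\<close> and to the empirical measure of the points
  \<open>z\<close> at the same time.\<close>

lemma exists_sparse_approximation:
  fixes p :: "'a \<Rightarrow> real" and v :: "'a \<Rightarrow> 'b \<Rightarrow> complex" and \<rho> :: "'b measure"
  assumes \<rho>: "prob_space \<rho>" and A: "finite A"
    and p: "\<And>a. a \<in> A \<Longrightarrow> 0 \<le> p a" "sum p A = 1"
    and meas: "\<And>a. a \<in> A \<Longrightarrow> v a \<in> borel_measurable \<rho>"
    and v\<rho>: "AE u in \<rho>. \<forall>a\<in>A. cmod (v a u) \<le> c"
    and vz: "\<And>i a. i < n \<Longrightarrow> a \<in> A \<Longrightarrow> cmod (v a (z i)) \<le> c"
    and t: "0 < t" "t \<le> c" and k: "0 < k" and n: "0 < n"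
  defines "D \<equiv> \<lambda>J u. cmod ((\<Sum>l<k. v (J l) u) / of_nat k - (\<Sum>a\<in>A. p a * v a u))"
    and "\<alpha> \<equiv> 8 * exp (- real k * t\<^sup>2 / (64 * c\<^sup>2))"
  shows "\<exists>J\<in>{..<k} \<rightarrow>\<^sub>E A. measure \<rho> {u\<in>space \<rho>. t \<le> D J u} \<le> \<alpha> \<and>
                        real (card {i. i < n \<and> t \<le> D J (z i)}) \<le> real n * \<alpha>"
proof -
  interpret prob_space \<rho> by fact
  define \<Omega> where "\<Omega> = {..<k} \<rightarrow>\<^sub>E A"
  define W where "W = (\<lambda>J. \<Prod>l<k. p (J l))"
  have fin: "finite \<Omega>" using A by (auto simp: \<Omega>_def intro: finite_PiE)
  have W0: "0 \<le> W J" if "J \<in> \<Omega>" for J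
    using that p(1) by (auto simp: W_def \<Omega>_def intro!: prod_nonneg)
  have W1: "sum W \<Omega> = 1"
    using prod_sum_PiE[of "{..<k}" "\<lambda>_. A" "\<lambda>_. p"] A p by (simp add: W_def \<Omega>_def)
  \<comment> \<open>At a fixed \<open>u\<close> few draws deviate. Averaging over \<open>u\<close>,
    once against \<open>\<rho>\<close> and once over the points \<open>z i\<close>, and exchanging
    the order bounds the mean size of the exceptional set of a draw.\<close>
  have point: "(\<Sum>J\<in>\<Omega>. W J * of_bool (t \<le> D J u)) \<le> \<alpha> / 2"
    if "\<forall>a\<in>A. cmod (v a u) \<le> c" for u
    using sampling_deviation[OF A p, of "\<lambda>a. v a u" c t k] that t k
    by (simp add: W_def \<Omega>_def D_def \<alpha>_def)
  have measv: "v (J l) \<in> borel_measurable \<rho>" if "J \<in> \<Omega>" "l < k" for J l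
    using that meas by (auto simp: \<Omega>_def)
  have measD: "D J \<in> borel_measurable \<rho>" if "J \<in> \<Omega>" for J
    unfolding D_def using measv[OF that] meas
    by (auto intro!: borel_measurable_sum borel_measurable_divide borel_measurable_diff borel_measurable_times
        borel_measurable_norm[THEN measurable_compose_rev] borel_measurable_const)
  define F where "F = (\<lambda>J. measure \<rho> {u\<in>space \<rho>. t \<le> D J u})"
  define G where "G = (\<lambda>J. real (card {i. i < n \<and> t \<le> D J (z i)}))"
  have intb: "integrable \<rho> (\<lambda>u. of_bool (t \<le> D J u) :: real)" if "J \<in> \<Omega>" for J
    using measD[OF that] by (intro integrable_const_bound[of _ 1]) auto
  have "(\<Sum>J\<in>\<Omega>. W J * F J) = (\<Sum>J\<in>\<Omega>. W J * (\<integral>u. of_bool (t \<le> D J u) \<partial>\<rho>))"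
  proof (intro sum.cong refl arg_cong2[where f = "(*)"])
    fix J assume "J \<in> \<Omega>"
    then have "{u\<in>space \<rho>. t \<le> D J u} \<in> sets \<rho>" using measD by measurable
    then have "F J = (\<integral>u. indicator {u\<in>space \<rho>. t \<le> D J u} u \<partial>\<rho>)" by (simp add: F_def)
    also have "\<dots> = (\<integral>u. of_bool (t \<le> D J u) \<partial>\<rho>)"
      by (rule Bochner_Integration.integral_cong) (auto simp: indicator_def)
    finally show "F J = (\<integral>u. of_bool (t \<le> D J u) \<partial>\<rho>)" .
  qed
  also have "\<dots> = (\<integral>u. (\<Sum>J\<in>\<Omega>. W J * of_bool (t \<le> D J u)) \<partial>\<rho>)"
    using intb by (subst Bochner_Integration.integral_sum) auto
  also have "\<dots> \<le> (\<integral>u. \<alpha> / 2 \<partial>\<rho>)"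
  proof (rule integral_mono_AE)
    show "AE u in \<rho>. (\<Sum>J\<in>\<Omega>. W J * of_bool (t \<le> D J u)) \<le> \<alpha> / 2"
      using v\<rho> point by (auto elim!: eventually_mono)
  qed (use intb in auto)
  finally have F: "(\<Sum>J\<in>\<Omega>. W J * F J) \<le> \<alpha> / 2" by (simp add: prob_space)
  have "(\<Sum>J\<in>\<Omega>. W J * G J) = (\<Sum>J\<in>\<Omega>. W J * (\<Sum>i<n. of_bool (t \<le> D J (z i))))"
    by (intro sum.cong refl arg_cong2[where f = "(*)"]) (simp add: G_def of_bool_def sum.If_cases Int_def)
  also have "\<dots> = (\<Sum>i<n. \<Sum>J\<in>\<Omega>. W J * of_bool (t \<le> D J (z i)))"
    by (simp only: sum_distrib_left) (rule sum.swap)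
  also have "\<dots> \<le> (\<Sum>i<n. \<alpha> / 2)"
    using point vz by (intro sum_mono) auto
  finally have G: "(\<Sum>J\<in>\<Omega>. W J * (G J / real n)) \<le> \<alpha> / 2"
    using n by (simp add: sum_divide_distrib[symmetric] field_simps)
  \<comment> \<open>Each of the two measures contributes \<open>\<alpha> / 2\<close>, which is why
    \<open>\<alpha>\<close> carries 8 rather than 4. A draw with sum at most \<open>\<alpha>\<close>
    is good for both, as both terms are nonnegative.\<close>
  have "(\<Sum>J\<in>\<Omega>. W J * (F J + G J / real n)) \<le> \<alpha>"
    using F G by (simp add: distrib_left sum.distrib)
  then obtain J where J: "J \<in> \<Omega>" "F J + G J / real n \<le> \<alpha>"
    using exists_le_weighted_mean[OF fin W0 W1, of "\<lambda>J. F J + G J / real n" \<alpha>] by blast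
  have "0 \<le> F J" "0 \<le> G J / real n" by (auto simp: F_def G_def)
  then have "F J \<le> \<alpha>" "G J / real n \<le> \<alpha>" using J(2) by linarith+
  then show ?thesis
    using J(1) n by (intro bexI[of _ J]) (auto simp: F_def G_def \<Omega>_def field_simps)
qed

text \<open>The positive and negative parts of \<open>Re (h j)\<close> and \<open>Im (h j)\<close>
  become the weights of the phases 1, -1, \<open>\<i>\<close> and \<open>- \<i>\<close>. Real and
  imaginary part together are at most twice the modulus, so dividing by \<open>2 * r\<close> leaves
  total weight at most 1.\<close>

lemma convex_combination_of_phases:
  fixes h :: "nat \<Rightarrow> complex"
  assumes m: "0 < m" and r: "0 < r" and h: "(\<Sum>j<m. cmod (h j)) \<le> r"
  obtains p :: "nat \<times> nat \<Rightarrow> real"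
  where "\<And>a. 0 \<le> p a" "sum p ({..<m} \<times> {..<4}) = 1"
    "\<And>g :: nat \<Rightarrow> complex. (\<Sum>a\<in>{..<m} \<times> {..<4}. p a * (complex_of_real (2 * r) * \<i> ^ snd a * g (fst a))) = (\<Sum>j<m. h j * g j)"
proof -
  define w where "w = (\<Sum>j<m. \<bar>Re (h j)\<bar> + \<bar>Im (h j)\<bar>) / (2 * r)"
  \<comment> \<open>The missing mass \<open>1 - w\<close> is spread evenly over the opposite phases
    1 and -1 of every index, where it cancels.\<close>
  define b where "b = (1 - w) / (2 * m)"
  define p where "p = (\<lambda>(j, q :: nat).
    if q = 0 then max (Re (h j)) 0 / (2 * r) + b
    else if q = 1 then max (Im (h j)) 0 / (2 * r)
    else if q = 2 then max (- Re (h j)) 0 / (2 * r) + b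
    else max (- Im (h j)) 0 / (2 * r))"
  have four: "{..<4} = {0, 1, 2, 3 :: nat}" by auto
  have i3: "\<i> ^ 3 = - \<i>" by (simp add: power3_eq_cube)
  have "(\<Sum>j<m. \<bar>Re (h j)\<bar> + \<bar>Im (h j)\<bar>) \<le> (\<Sum>j<m. 2 * cmod (h j))"
    using abs_Re_le_cmod abs_Im_le_cmod by (intro sum_mono) (smt (verit))
  also have "\<dots> \<le> 2 * r" using h by (simp add: sum_distrib_left[symmetric])
  finally have "w \<le> 1" using r by (simp add: w_def)
  then have b: "0 \<le> b" by (simp add: b_def)
  show ?thesis
  proof (rule that[of p])
    show "0 \<le> p a" for a using b r by (auto simp: p_def split: prod.split)
    have "sum p ({..<m} \<times> {..<4}) = (\<Sum>j<m. \<Sum>q<4. p (j, q))"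
      by (simp add: sum.cartesian_product)
    also have "\<dots> = (\<Sum>j<m. (\<bar>Re (h j)\<bar> + \<bar>Im (h j)\<bar>) / (2 * r) + 2 * b)"
      using r 
      by (intro sum.cong refl) (simp add: four p_def add_divide_distrib[symmetric] abs_if max_def)
    also have "\<dots> = w + real m * (2 * b)"
      unfolding w_def sum_divide_distrib by (subst sum.distrib) simp
    also have "\<dots> = 1" using m by (simp add: b_def field_simps)
    finally show "sum p ({..<m} \<times> {..<4}) = 1" .
    fix g :: "nat \<Rightarrow> complex"
    have diff: "p (j, 0) - p (j, 2) = Re (h j) / (2 * r)" "p (j, 1) - p (j, 3) = Im (h j) / (2 * r)" for j
      by (auto simp: p_def max_def field_simps)
    have "(\<Sum>a\<in>{..<m} \<times> {..<4}. p a * (complex_of_real (2 * r) * \<i> ^ snd a * g (fst a)))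
        = (\<Sum>j<m. \<Sum>q<4. p (j, q) * (complex_of_real (2 * r) * \<i> ^ q * g j))"
      by (simp add: sum.cartesian_product case_prod_beta)
    also have "\<dots> = (\<Sum>j<m. h j * g j)"
    proof (intro sum.cong refl)
      fix j
      have "(\<Sum>q<4. p (j, q) * (complex_of_real (2 * r) * \<i> ^ q * g j))
          = (of_real (p (j, 0) - p (j, 2)) + \<i> * of_real (p (j, 1) - p (j, 3))) * complex_of_real (2 * r) * g j"
        by (simp add: four i3 algebra_simps)
      also have "\<dots> = h j * g j"
        unfolding diff using r by (simp add: field_simps complex_eq[symmetric])
      finally show "(\<Sum>q<4. p (j, q) * (complex_of_real (2 * r) * \<i> ^ q * g j)) = h j * g j" .
    qed
    finally show "(\<Sum>a\<in>{..<m} \<times> {..<4}. p a * (complex_of_real (2 * r) * \<i> ^ snd a * g (fst a))) = (\<Sum>j<m. h j * g j)" .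
  qed
qed

section \<open>Counting sample points in a set\<close>

text \<open>Chernoff's method with exponent -1: as \<open>exp (-1) \<le> 1 / 2\<close>, one factor
  has mean at most \<open>1 - P / 2 \<le> exp (- P / 2)\<close>. Markov's inequality at the
  threshold \<open>exp (- real n * P / 4)\<close> gives back half of the total exponent.\<close>

lemma (in prob_space) count_lower_tail:
  assumes indep: "indep_vars (\<lambda>_. N) x {..<n}" and U: "U \<in> sets N"
    and P: "\<And>i. i < n \<Longrightarrow> P \<le> prob (x i -` U \<inter> space M)"
  shows "prob {\<omega>\<in>space M. real (card {i. i < n \<and> x i \<omega> \<in> U}) \<le> real n * P / 4} \<le> exp (- real n * P / 4)"
proof -
  define Y where "Y = (\<lambda>i \<omega>. exp (- indicator U (x i \<omega>) :: real))"
  have x: "x i \<in> M \<rightarrow>\<^sub>M N" if "i < n" for i using indep that by (simp add: indep_vars_def)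
  note [measurable] = U
  have "indep_vars (\<lambda>_. borel) (\<lambda>i \<omega>. (\<lambda>u. exp (- indicator U u :: real)) (x i \<omega>)) {..<n}"
    by (intro indep_vars_compose2[OF indep]) measurable
  then have indY: "indep_vars (\<lambda>_. borel) Y {..<n}" by (simp add: Y_def)
  have measY: "Y i \<in> borel_measurable M" if "i < n" for i
    using x[OF that] U unfolding Y_def by measurable
  have intY: "integrable M (Y i)" if "i < n" for i
    using measY[OF that] by (intro integrable_const_bound[of _ 1]) (auto simp: Y_def indicator_def)
  have EY: "expectation (Y i) \<le> exp (- P / 2)" if i: "i < n" for i
  proof -
    define V where "V = x i -` U \<inter> space M"
    have V: "V \<in> events" using x[OF i] U by (simp add: V_def measurable_sets)
    have e: "exp (-1 :: real) \<le> 1 / 2"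
      using exp_ge_add_one_self[of "1 :: real"] by (simp add: exp_minus field_simps)
    have "expectation (Y i) \<le> expectation (\<lambda>\<omega>. 1 - indicator V \<omega> / 2)"
    proof (rule integral_mono[OF intY[OF i]])
      show "integrable M (\<lambda>\<omega>. 1 - indicator V \<omega> / 2 :: real)"
        using V by (intro integrable_const_bound[of _ 1]) (auto simp: indicator_def)
      show "Y i \<omega> \<le> 1 - indicator V \<omega> / 2" if "\<omega> \<in> space M" for \<omega>
        using e that by (simp add: Y_def V_def indicator_def)
    qed
    also have "\<dots> = 1 - prob V / 2"
    proof -
      have "integrable M (\<lambda>\<omega>. indicator V \<omega> / 2 :: real)"
        using V by (intro integrable_const_bound[of _ 1]) (auto simp: indicator_def)
      then show ?thesis using V by (simp add: prob_space)
    qed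
    also have "\<dots> \<le> 1 - P / 2" using P[OF i] by (simp add: V_def)
    also have "\<dots> \<le> exp (- P / 2)" using exp_ge_add_one_self[of "- P / 2"] by simp
    finally show ?thesis .
  qed
  have prodY: "(\<Prod>i<n. Y i \<omega>) = exp (- real (card {i. i < n \<and> x i \<omega> \<in> U}))" for \<omega>
  proof -
    have "(\<Sum>i<n. - indicator U (x i \<omega>)) = - real (card {i. i < n \<and> x i \<omega> \<in> U})"
      by (simp add: indicator_def sum_negf sum.If_cases Int_def)
    then show ?thesis by (simp add: Y_def exp_sum[symmetric])
  qed
  have "expectation (\<lambda>\<omega>. \<Prod>i<n. Y i \<omega>) = (\<Prod>i<n. expectation (Y i))"
    using indY intY by (intro indep_vars_lebesgue_integral) auto
  also have "\<dots> \<le> (\<Prod>i<n. exp (- P / 2))"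
    using EY by (intro prod_mono) (auto simp: Y_def)
  also have "\<dots> = exp (- real n * P / 2)" by (simp add: exp_of_nat_mult[symmetric])
  finally have E: "expectation (\<lambda>\<omega>. \<Prod>i<n. Y i \<omega>) \<le> exp (- real n * P / 2)" .
  have "prob {\<omega>\<in>space M. real (card {i. i < n \<and> x i \<omega> \<in> U}) \<le> real n * P / 4}
      = prob {\<omega>\<in>space M. (\<Prod>i<n. Y i \<omega>) \<ge> exp (- real n * P / 4)}"
    by (rule arg_cong[where f = prob]) (auto simp: prodY)
  also have "\<dots> \<le> expectation (\<lambda>\<omega>. \<Prod>i<n. Y i \<omega>) / exp (- real n * P / 4)"
  proof (rule integral_Markov_inequality_measure)
    show "integrable M (\<lambda>\<omega>. \<Prod>i<n. Y i \<omega>)" using indY intY by (intro indep_vars_integrable) auto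
  qed (auto simp: Y_def intro!: prod_nonneg)
  also have "\<dots> \<le> exp (- real n * P / 2) / exp (- real n * P / 4)"
    using E by (intro divide_right_mono) auto
  also have "\<dots> = exp (- real n * P / 4)"
    by (simp add: exp_diff[symmetric])
  finally show ?thesis .
qed

section \<open>Levels of an orthonormal combination\<close>

text \<open>Below \<open>1 / 2\<close> the function contributes at most \<open>1 / 4\<close> to the
  integral 1 of its square. If every level were small, each of the \<open>Q\<close> dyadic terms
  would contribute less than \<open>3 / (4 * real Q)\<close>, too little for the remaining
  \<open>3 / 4\<close>.\<close>

lemma exists_level:
  fixes f :: "'a \<Rightarrow> complex" and \<rho> :: "'a measure"
  assumes \<rho>: "prob_space \<rho>" and f: "sq_integrable \<rho> f" "(\<integral>u. (cmod (f u))\<^sup>2 \<partial>\<rho>) = 1"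
    and R: "AE u in \<rho>. cmod (f u) \<le> R" and Q: "R < 2 ^ Q / 2"
  shows "\<exists>q<Q. 3 / (16 * real Q * (2 ^ q / 2)\<^sup>2) \<le> measure \<rho> {u\<in>space \<rho>. 2 ^ q / 2 \<le> cmod (f u)}"
proof (rule ccontr)
  interpret prob_space \<rho> by fact
  assume "\<not> ?thesis"
  then have small: "measure \<rho> {u\<in>space \<rho>. 2 ^ q / 2 \<le> cmod (f u)} < 3 / (16 * real Q * (2 ^ q / 2)\<^sup>2)"
    if "q < Q" for q using that by force
  have meas [measurable]: "f \<in> borel_measurable \<rho>" using f(1) by (simp add: sq_integrable_def)
  define T where "T = (\<lambda>q. {u\<in>space \<rho>. 2 ^ q / 2 \<le> cmod (f u)})"
  have T [measurable]: "T q \<in> sets \<rho>" for q unfolding T_def by measurable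
  have pointwise: "(cmod (f u))\<^sup>2 \<le> 1 / 4 + (\<Sum>q<Q. 2 ^ (2 * q) * indicator (T q) u)"
    if u: "cmod (f u) \<le> R" "u \<in> space \<rho>" for u
  proof (cases "cmod (f u) < 1 / 2")
    case True
    then have "(cmod (f u))\<^sup>2 \<le> (1 / 2)\<^sup>2" by (intro power_mono) auto
    moreover have "0 \<le> (\<Sum>q<Q. 2 ^ (2 * q) * indicator (T q) u :: real)" by (intro sum_nonneg) auto
    ultimately show ?thesis by (simp add: power2_eq_square)
  next
    case False
    \<comment> \<open>With \<open>q = Suc q'\<close>, the modulus lies between
      \<open>2 ^ q' / 2\<close> and \<open>2 ^ q'\<close>, so the single term \<open>q'\<close> of
      the sum already bounds its square.\<close>
    define q where "q = (LEAST q. cmod (f u) < 2 ^ q / 2)"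
    have ex: "cmod (f u) < 2 ^ Q / 2" using u Q by linarith
    have lt: "cmod (f u) < 2 ^ q / 2" unfolding q_def using ex by (rule LeastI)
    have "q \<le> Q" unfolding q_def using ex by (rule Least_le)
    have "q \<noteq> 0" using lt False by (intro notI) simp
    then obtain q' where q': "q = Suc q'" by (cases q) auto
    have "\<not> cmod (f u) < 2 ^ q' / 2"
      using not_less_Least[of q' "\<lambda>q. cmod (f u) < 2 ^ q / 2"] q' unfolding q_def[symmetric] by simp
    then have "u \<in> T q'" using u by (simp add: T_def)
    have "(cmod (f u))\<^sup>2 \<le> (2 ^ q / 2)\<^sup>2" using lt by (intro power_mono) auto
    also have "\<dots> = 2 ^ (2 * q') * indicator (T q') u"
      using \<open>u \<in> T q'\<close> by (simp add: q' power_mult power2_eq_square power_mult_distrib[symmetric])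
    also have "\<dots> \<le> (\<Sum>q<Q. 2 ^ (2 * q) * indicator (T q) u)"
      using \<open>q \<le> Q\<close> q' by (intro member_le_sum) auto
    finally show ?thesis by simp
  qed
  have intT: "integrable \<rho> (\<lambda>u. 2 ^ (2 * q) * indicator (T q) u :: real)" for q
    by (intro integrable_mult_right integrable_real_indicator) (auto simp: less_top[symmetric])
  have int: "integrable \<rho> (\<lambda>u. 1 / 4 + (\<Sum>q<Q. 2 ^ (2 * q) * indicator (T q) u) :: real)"
    by (intro Bochner_Integration.integrable_add Bochner_Integration.integrable_sum intT) auto
  have "1 = (\<integral>u. (cmod (f u))\<^sup>2 \<partial>\<rho>)" by (simp add: f(2))
  also have "\<dots> \<le> (\<integral>u. 1 / 4 + (\<Sum>q<Q. 2 ^ (2 * q) * indicator (T q) u) \<partial>\<rho>)"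
  proof (rule integral_mono_AE[OF _ int])
    show "AE u in \<rho>. (cmod (f u))\<^sup>2 \<le> 1 / 4 + (\<Sum>q<Q. 2 ^ (2 * q) * indicator (T q) u)"
      using R by (rule AE_mp) (use pointwise in \<open>auto intro: AE_I2\<close>)
  qed (use f(1) in \<open>simp add: sq_integrable_def\<close>)
  also have "\<dots> = 1 / 4 + (\<Sum>q<Q. 2 ^ (2 * q) * measure \<rho> (T q))"
  proof -
    have "(\<integral>u. (\<Sum>q<Q. 2 ^ (2 * q) * indicator (T q) u) \<partial>\<rho>) = (\<Sum>q<Q. 2 ^ (2 * q) * measure \<rho> (T q))"
      by (subst Bochner_Integration.integral_sum[OF intT]) simp
    then show ?thesis
      by (subst Bochner_Integration.integral_add)
         (auto simp: prob_space simp del: sum_mult_indicator intro!: Bochner_Integration.integrable_sum intT)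
  qed
  finally have sum: "3 / 4 \<le> (\<Sum>q<Q. 2 ^ (2 * q) * measure \<rho> (T q))" by simp
  have "0 < Q" using sum by (cases Q) auto
  have "(\<Sum>q<Q. 2 ^ (2 * q) * measure \<rho> (T q)) < (\<Sum>q<Q. 3 / (4 * real Q))"
  proof (rule sum_strict_mono)
    fix q assume "q \<in> {..<Q}"
    then have "2 ^ (2 * q) * measure \<rho> (T q) < 2 ^ (2 * q) * (3 / (16 * real Q * (2 ^ q / 2)\<^sup>2))"
      using small[of q] by (intro mult_strict_left_mono) (auto simp: T_def)
    also have "\<dots> = 3 / (4 * real Q)"
      by (simp add: power_mult power2_eq_square power_mult_distrib[symmetric] field_simps)
    finally show "2 ^ (2 * q) * measure \<rho> (T q) < 3 / (4 * real Q)" .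
  qed (use \<open>0 < Q\<close> in auto)
  also have "\<dots> = 3 / 4" using \<open>0 < Q\<close> by simp
  finally show False using sum by simp
qed

lemma sq_integrable_mult_cnj:
  assumes "sq_integrable \<rho> f" "sq_integrable \<rho> g"
  shows "integrable \<rho> (\<lambda>u. f u * cnj (g u))"
proof (rule Bochner_Integration.integrable_bound)
  have [measurable]: "f \<in> borel_measurable \<rho>" "g \<in> borel_measurable \<rho>"
    using assms by (auto simp: sq_integrable_def)
  show "integrable \<rho> (\<lambda>u. (cmod (f u))\<^sup>2 + (cmod (g u))\<^sup>2)"
    using assms by (simp add: sq_integrable_def)
  have "(\<lambda>u. cnj (g u)) \<in> borel_measurable \<rho>"
    by (intro borel_measurable_continuous_on[where f = cnj] continuous_intros) auto
  then show "(\<lambda>u. f u * cnj (g u)) \<in> borel_measurable \<rho>" by simp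
  show "AE u in \<rho>. norm (f u * cnj (g u)) \<le> norm ((cmod (f u))\<^sup>2 + (cmod (g u))\<^sup>2)"
  proof (rule AE_I2)
    fix u
    have "0 \<le> cmod (f u) * cmod (g u)" by simp
    then show "norm (f u * cnj (g u)) \<le> norm ((cmod (f u))\<^sup>2 + (cmod (g u))\<^sup>2)"
      using sum_squares_bound[of "cmod (f u)" "cmod (g u)"] unfolding norm_mult complex_mod_cnj real_norm_def
      by linarith
  qed
qed

text \<open>Parseval's identity: in the expansion of the square as a double sum the off-diagonal
  integrals vanish.\<close>

lemma orthonormal_combination:
  fixes h :: "nat \<Rightarrow> complex"
  assumes on: "L2_orthonormal \<rho> m \<psi>"
  defines "f \<equiv> \<lambda>u. \<Sum>j<m. h j * \<psi> j u"
  shows "sq_integrable \<rho> f" "(\<integral>u. (cmod (f u))\<^sup>2 \<partial>\<rho>) = (\<Sum>j<m. (cmod (h j))\<^sup>2)"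
proof -
  have sq: "sq_integrable \<rho> (\<psi> j)" if "j < m" for j using on that by (simp add: L2_orthonormal_def)
  have int: "integrable \<rho> (\<lambda>u. \<psi> i u * cnj (\<psi> j u))" if "i < m" "j < m" for i j
    using sq_integrable_mult_cnj sq that by blast
  have on': "(\<integral>u. \<psi> i u * cnj (\<psi> j u) \<partial>\<rho>) = (if i = j then 1 else 0)" if "i < m" "j < m" for i j
    using on that by (simp add: L2_orthonormal_def L2_inner_def)
  have expand: "complex_of_real ((cmod (f u))\<^sup>2) = (\<Sum>i<m. \<Sum>j<m. (h i * cnj (h j)) * (\<psi> i u * cnj (\<psi> j u)))" for u
    unfolding complex_norm_square f_def cnj_sum sum_product by (simp add: mult_ac)
  have intf: "integrable \<rho> (\<lambda>u. complex_of_real ((cmod (f u))\<^sup>2))"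
    unfolding expand by (intro Bochner_Integration.integrable_sum integrable_mult_right int) auto
  have meas: "f \<in> borel_measurable \<rho>"
    using sq unfolding f_def sq_integrable_def
    by (intro borel_measurable_sum borel_measurable_times borel_measurable_const) blast
  show "sq_integrable \<rho> f"
    using meas integrable_Re[OF intf] by (simp add: sq_integrable_def)
  have "complex_of_real (\<integral>u. (cmod (f u))\<^sup>2 \<partial>\<rho>) = (\<integral>u. complex_of_real ((cmod (f u))\<^sup>2) \<partial>\<rho>)"
    by (rule integral_complex_of_real[symmetric])
  also have "\<dots> = (\<Sum>i<m. \<Sum>j<m. (h i * cnj (h j)) * (if i = j then 1 else 0))"
    unfolding expand using int
    by (subst Bochner_Integration.integral_sum, force)
       (intro sum.cong refl, subst Bochner_Integration.integral_sum, auto simp: on' intro!: sum.cong)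
  also have "\<dots> = complex_of_real (\<Sum>j<m. (cmod (h j))\<^sup>2)"
    unfolding of_real_sum complex_norm_square by (simp add: if_distrib cong: if_cong)
  finally show "(\<integral>u. (cmod (f u))\<^sup>2 \<partial>\<rho>) = (\<Sum>j<m. (cmod (h j))\<^sup>2)"
    by (simp only: of_real_eq_iff)
qed

section \<open>The sampling event\<close>

text \<open>A member of the net: the phase \<open>\<i> ^ q\<close> and the index \<open>j\<close> of each of the \<open>k\<close> terms are given by
  \<open>J\<close> as the pair \<open>(j, q)\<close>.\<close>

definition phase_mean ::
    "real \<Rightarrow> (nat \<Rightarrow> 'a \<Rightarrow> complex) \<Rightarrow> nat \<Rightarrow> (nat \<Rightarrow> nat \<times> nat) \<Rightarrow> 'a \<Rightarrow> complex" where
  "phase_mean r \<psi> k J u = (\<Sum>l<k. complex_of_real (2 * r) * \<i> ^ snd (J l) * \<psi> (fst (J l)) u) / of_nat k"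

text \<open>The deterministic half of the argument, on a sample that satisfies \<open>net\<close>.
  With \<open>t = 2 ^ q / 2\<close> and mass unit \<open>w\<close>, the set where \<open>f\<close>
  reaches \<open>t\<close> has mass at least \<open>12 * w\<close>. The approximating net element
  reaches \<open>t / 2\<close> on mass at least \<open>4 * w\<close>, hence at more than
  \<open>real n * w\<close> sample points, and it is off by \<open>t / 4\<close> at no more than
  that many. At a remaining point \<open>f\<close> exceeds \<open>t / 4\<close>, which is at least
  \<open>1 / 8\<close>.\<close>

lemma exists_large_value:
  fixes h :: "nat \<Rightarrow> complex" and \<psi> :: "nat \<Rightarrow> 'a \<Rightarrow> complex" and z :: "nat \<Rightarrow> 'a"
  assumes \<rho>: "prob_space \<rho>" and on: "L2_orthonormal \<rho> m \<psi>"
    and B: "AE u in \<rho>. \<forall>j<m. cmod (\<psi> j u) \<le> B" "0 < B"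
    and z: "\<And>i. i < n \<Longrightarrow> z i \<in> space \<rho>" "\<And>i j. i < n \<Longrightarrow> j < m \<Longrightarrow> cmod (\<psi> j (z i)) \<le> B"
    and r: "0 < r" and h: "(\<Sum>j<m. cmod (h j)) \<le> r" "(\<Sum>j<m. (cmod (h j))\<^sup>2) = 1"
    and n: "0 < n" and Q: "B * r < 2 ^ Q / 2" "\<And>q. q < Q \<Longrightarrow> 2 ^ q / 2 \<le> B * r"
    and k: "\<And>q. q < Q \<Longrightarrow> 0 < k q"
      "\<And>q. q < Q \<Longrightarrow> 8 * exp (- real (k q) * (2 ^ q / 2)\<^sup>2 / (4096 * (B * r)\<^sup>2)) \<le> 1 / (64 * real Q * (2 ^ q / 2)\<^sup>2)"
    and net: "\<And>q J. q < Q \<Longrightarrow> J \<in> {..<k q} \<rightarrow>\<^sub>E ({..<m} \<times> {..<4}) \<Longrightarrow>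
      1 / (16 * real Q * (2 ^ q / 2)\<^sup>2) \<le> measure \<rho> {u\<in>space \<rho>. 2 ^ q / 4 \<le> cmod (phase_mean r \<psi> (k q) J u)} \<Longrightarrow>
      real n / (64 * real Q * (2 ^ q / 2)\<^sup>2) <
        card {i. i < n \<and> z i \<in> {u\<in>space \<rho>. 2 ^ q / 4 \<le> cmod (phase_mean r \<psi> (k q) J u)}}"
  shows "\<exists>i<n. 1 / 8 \<le> cmod (\<Sum>j<m. h j * \<psi> j (z i))"
proof -
  interpret prob_space \<rho> by fact
  define f where "f = (\<lambda>u. \<Sum>j<m. h j * \<psi> j u)"
  have f: "sq_integrable \<rho> f" "(\<integral>u. (cmod (f u))\<^sup>2 \<partial>\<rho>) = 1"
    using orthonormal_combination[OF on, of h] h(2) by (auto simp: f_def)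
  have m: "0 < m" using h(2) by (cases m) auto
  have fB: "AE u in \<rho>. cmod (f u) \<le> B * r"
    using B(1)
  proof (rule eventually_mono)
    fix u assume u: "\<forall>j<m. cmod (\<psi> j u) \<le> B"
    have "cmod (f u) \<le> (\<Sum>j<m. cmod (h j) * B)"
      unfolding f_def using u by (intro sum_norm_le) (auto simp: norm_mult intro!: mult_left_mono)
    also have "\<dots> \<le> B * r" using h(1) B(2) by (simp add: sum_distrib_right[symmetric] mult.commute[of B])
    finally show "cmod (f u) \<le> B * r" .
  qed
  obtain q where q: "q < Q"
    and level: "3 / (16 * real Q * (2 ^ q / 2)\<^sup>2) \<le> measure \<rho> {u\<in>space \<rho>. 2 ^ q / 2 \<le> cmod (f u)}"
    using exists_level[OF \<rho> f fB Q(1)] by blast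
  define t :: real where "t = 2 ^ q / 2"
  have t: "1 / 2 \<le> t" by (simp add: t_def)
  define w where "w = 1 / (64 * real Q * t\<^sup>2)"
  obtain p :: "nat \<times> nat \<Rightarrow> real" where p: "\<And>a. 0 \<le> p a" "sum p ({..<m} \<times> {..<4}) = 1"
    and pf: "\<And>g :: nat \<Rightarrow> complex. (\<Sum>a\<in>{..<m} \<times> {..<4}. p a * (complex_of_real (2 * r) * \<i> ^ snd a * g (fst a))) = (\<Sum>j<m. h j * g j)"
    by (rule convex_combination_of_phases[OF m r h(1)]) (rule that)
  define A where "A = {..<m} \<times> {..<4 :: nat}"
  define v where "v = (\<lambda>a u. complex_of_real (2 * r) * \<i> ^ snd a * \<psi> (fst a) u)"
  have vc: "cmod (v a u) \<le> 2 * (B * r)" if "a \<in> A" "\<forall>j<m. cmod (\<psi> j u) \<le> B" for a u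
  proof -
    have "cmod (v a u) = 2 * r * cmod (\<psi> (fst a) u)"
      using r by (simp add: v_def norm_mult norm_power)
    also have "\<dots> \<le> 2 * r * B" using that r by (intro mult_left_mono) (auto simp: A_def)
    finally show ?thesis by (simp add: mult_ac)
  qed
  have meas\<psi>: "\<psi> j \<in> borel_measurable \<rho>" if "j < m" for j
    using on that by (simp add: L2_orthonormal_def sq_integrable_def)
  have measv: "v a \<in> borel_measurable \<rho>" if "a \<in> A" for a
    using meas\<psi>[of "fst a"] that by (auto simp: v_def A_def)
  have sumv: "(\<Sum>a\<in>A. p a * v a u) = f u" for u
    using pf[of "\<lambda>j. \<psi> j u"] by (simp add: A_def v_def f_def)
  have sumJ: "(\<Sum>l<k q. v (J l) u) / of_nat (k q) = phase_mean r \<psi> (k q) J u" for J u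
    by (simp add: phase_mean_def v_def)
  have "\<exists>J\<in>{..<k q} \<rightarrow>\<^sub>E A.
      measure \<rho> {u\<in>space \<rho>. t / 4 \<le> cmod ((\<Sum>l<k q. v (J l) u) / of_nat (k q) - (\<Sum>a\<in>A. p a * v a u))}
        \<le> 8 * exp (- real (k q) * (t / 4)\<^sup>2 / (64 * (2 * (B * r))\<^sup>2)) \<and>
      real (card {i. i < n \<and> t / 4 \<le> cmod ((\<Sum>l<k q. v (J l) (z i)) / of_nat (k q) - (\<Sum>a\<in>A. p a * v a (z i)))})
        \<le> real n * (8 * exp (- real (k q) * (t / 4)\<^sup>2 / (64 * (2 * (B * r))\<^sup>2)))"
  proof (rule exists_sparse_approximation[OF \<rho> _ p(1)])
    show "AE u in \<rho>. \<forall>a\<in>A. cmod (v a u) \<le> 2 * (B * r)"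
      using B(1) by (rule eventually_mono) (use vc in blast)
    show "t / 4 \<le> 2 * (B * r)" using Q(2)[OF q] t unfolding t_def by linarith
  qed (use t k(1)[OF q] n measv vc z(2) p(2) in \<open>auto simp: A_def\<close>)
  \<comment> \<open>The 4096 is 64 * 16 * 4: the tolerance \<open>t / 4\<close> contributes 16 and
    the uniform bound \<open>2 * (B * r)\<close> on the terms contributes 4.\<close>
  moreover have "8 * exp (- real (k q) * (t / 4)\<^sup>2 / (64 * (2 * (B * r))\<^sup>2)) \<le> w"
  proof -
    have "- real (k q) * (t / 4)\<^sup>2 / (64 * (2 * (B * r))\<^sup>2) = - real (k q) * t\<^sup>2 / (4096 * (B * r)\<^sup>2)"
      by (simp add: power_divide power_mult_distrib)
    then show ?thesis using k(2)[OF q] by (simp only: w_def t_def)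
  qed
  ultimately obtain J where J: "J \<in> {..<k q} \<rightarrow>\<^sub>E A"
    and bad\<rho>: "measure \<rho> {u\<in>space \<rho>. t / 4 \<le> cmod (phase_mean r \<psi> (k q) J u - f u)} \<le> w"
    and badz: "real (card {i. i < n \<and> t / 4 \<le> cmod (phase_mean r \<psi> (k q) J (z i) - f (z i))}) \<le> real n * w"
    unfolding sumv sumJ by (meson mult_left_mono of_nat_0_le_iff order_trans)
  have measf [measurable]: "f \<in> borel_measurable \<rho>" using f(1) by (simp add: sq_integrable_def)
  have measJ: "\<psi> (fst (J l)) \<in> borel_measurable \<rho>" if "l < k q" for l
  proof -
    have "J l \<in> A" using J that by auto
    then show ?thesis using meas\<psi>[of "fst (J l)"] by (auto simp: A_def)
  qed
  have measp [measurable]: "phase_mean r \<psi> (k q) J \<in> borel_measurable \<rho>"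
    unfolding phase_mean_def using measJ
    by (intro borel_measurable_divide borel_measurable_sum borel_measurable_times borel_measurable_const) auto
  define V where "V = {u\<in>space \<rho>. t / 2 \<le> cmod (phase_mean r \<psi> (k q) J u)}"
  have V: "V \<in> sets \<rho>" unfolding V_def by measurable
  have bad: "{u\<in>space \<rho>. t / 4 \<le> cmod (phase_mean r \<psi> (k q) J u - f u)} \<in> sets \<rho>" by measurable
  have w: "0 \<le> w" by (simp add: w_def)
  have "3 * (4 * w) \<le> measure \<rho> {u\<in>space \<rho>. t \<le> cmod (f u)}"
    using level by (simp add: w_def t_def)
  also have "\<dots> \<le> measure \<rho> (V \<union> {u\<in>space \<rho>. t / 4 \<le> cmod (phase_mean r \<psi> (k q) J u - f u)})"
  proof (rule finite_measure_mono)
    show "{u\<in>space \<rho>. t \<le> cmod (f u)} \<subseteq> V \<union> {u\<in>space \<rho>. t / 4 \<le> cmod (phase_mean r \<psi> (k q) J u - f u)}"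
    proof
      fix u assume u: "u \<in> {u\<in>space \<rho>. t \<le> cmod (f u)}"
      have "cmod (f u) \<le> cmod (phase_mean r \<psi> (k q) J u) + cmod (phase_mean r \<psi> (k q) J u - f u)"
        by (metis norm_minus_commute norm_triangle_sub)
      then show "u \<in> V \<union> {u\<in>space \<rho>. t / 4 \<le> cmod (phase_mean r \<psi> (k q) J u - f u)}"
        using u t by (auto simp: V_def)
    qed
  qed (use V bad in blast)
  also have "\<dots> \<le> measure \<rho> V + w"
    using measure_Un_le[OF V bad] bad\<rho> by linarith
  finally have "4 * w \<le> measure \<rho> V" using w by linarith
  then have "real n * w < card {i. i < n \<and> z i \<in> V}"
    using net[OF q, of J] J by (simp add: A_def V_def w_def t_def)
  with badz have "card {i. i < n \<and> t / 4 \<le> cmod (phase_mean r \<psi> (k q) J (z i) - f (z i))}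
      < card {i. i < n \<and> z i \<in> V}" by linarith
  then have "\<not> {i. i < n \<and> z i \<in> V} \<subseteq> {i. i < n \<and> t / 4 \<le> cmod (phase_mean r \<psi> (k q) J (z i) - f (z i))}"
    by (metis (no_types, lifting) card_mono finite_nat_set_iff_bounded mem_Collect_eq not_le)
  then obtain i where i: "i < n" "z i \<in> V" "\<not> t / 4 \<le> cmod (phase_mean r \<psi> (k q) J (z i) - f (z i))"
    by blast
  have "cmod (phase_mean r \<psi> (k q) J (z i)) \<le> cmod (f (z i)) + cmod (phase_mean r \<psi> (k q) J (z i) - f (z i))"
    by (rule norm_triangle_sub)
  then have "1 / 8 \<le> cmod (f (z i))" using i t by (simp add: V_def)
  then show ?thesis using i(1) by (auto simp: f_def)
qed

text \<open>A union bound over the net: level \<open>q\<close> has \<open>(4 * real m) ^ k q\<close>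
  members, and each often-large member fails with the Chernoff probability for
  \<open>P = 1 / (16 * real Q * (2 ^ q / 2)\<^sup>2)\<close>.\<close>

lemma (in prob_space) sampling_event:
  fixes \<psi> :: "nat \<Rightarrow> 'b \<Rightarrow> complex" and x :: "nat \<Rightarrow> 'a \<Rightarrow> 'b" and k :: "nat \<Rightarrow> nat"
  assumes \<rho>: "prob_space \<rho>" and meas: "\<And>j. j < m \<Longrightarrow> \<psi> j \<in> borel_measurable \<rho>"
    and B: "AE u in \<rho>. \<forall>j<m. cmod (\<psi> j u) \<le> B"
    and indep: "indep_vars (\<lambda>_. \<rho>) x {..<n}" and law: "\<And>i. i < n \<Longrightarrow> distr M \<rho> (x i) = \<rho>"
    and \<epsilon>: "(\<Sum>q<Q. (4 * real m) ^ k q * exp (- real n / (64 * real Q * (2 ^ q / 2)\<^sup>2))) < \<epsilon>"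
  shows "\<exists>G\<in>events. prob G > 1 - \<epsilon> \<and> (\<forall>\<omega>\<in>G. \<omega> \<in> space M \<and> (\<forall>i<n. \<forall>j<m. cmod (\<psi> j (x i \<omega>)) \<le> B) \<and>
    (\<forall>q<Q. \<forall>J\<in>{..<k q} \<rightarrow>\<^sub>E ({..<m} \<times> {..<4}).
      1 / (16 * real Q * (2 ^ q / 2)\<^sup>2) \<le> measure \<rho> {u\<in>space \<rho>. 2 ^ q / 4 \<le> cmod (phase_mean r \<psi> (k q) J u)} \<longrightarrow>
      real n / (64 * real Q * (2 ^ q / 2)\<^sup>2) <
        card {i. i < n \<and> x i \<omega> \<in> {u\<in>space \<rho>. 2 ^ q / 4 \<le> cmod (phase_mean r \<psi> (k q) J u)}}))"
proof -
  have x: "x i \<in> M \<rightarrow>\<^sub>M \<rho>" if "i < n" for i using indep that by (simp add: indep_vars_def)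
  define V where "V = (\<lambda>q J. {u\<in>space \<rho>. 2 ^ q / 4 \<le> cmod (phase_mean r \<psi> (k q) J u)})"
  define \<Omega> where "\<Omega> = (\<lambda>q. {..<k q} \<rightarrow>\<^sub>E ({..<m} \<times> {..<4 :: nat}))"
  define P where "P = (\<lambda>q. 1 / (16 * real Q * (2 ^ q / 2)\<^sup>2))"
  define I where "I = (SIGMA q:{..<Q}. {J\<in>\<Omega> q. P q \<le> measure \<rho> (V q J)})"
  define bad where "bad = (\<lambda>(q, J). {\<omega>\<in>space M. real (card {i. i < n \<and> x i \<omega> \<in> V q J}) \<le> real n * P q / 4})"
  have fin\<Omega>: "finite (\<Omega> q)" for q by (auto simp: \<Omega>_def intro: finite_PiE)
  then have finI: "finite I" by (auto simp: I_def)
  have card\<Omega>: "real (card (\<Omega> q)) = (4 * real m) ^ k q" for q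
    by (simp add: \<Omega>_def card_PiE mult.commute)
  have V: "V q J \<in> sets \<rho>" if "J \<in> \<Omega> q" for q J
  proof -
    have "\<psi> (fst (J l)) \<in> borel_measurable \<rho>" if "l < k q" for l
    proof -
      have "J l \<in> {..<m} \<times> {..<4}" using \<open>J \<in> \<Omega> q\<close> that by (auto simp: \<Omega>_def)
      then show ?thesis using meas[of "fst (J l)"] by auto
    qed
    then have [measurable]: "phase_mean r \<psi> (k q) J \<in> borel_measurable \<rho>"
      unfolding phase_mean_def
      by (intro borel_measurable_divide borel_measurable_sum borel_measurable_times borel_measurable_const) auto
    show ?thesis unfolding V_def by measurable
  qed
  have Bset: "{\<omega>\<in>space M. \<forall>i<n. \<forall>j<m. cmod (\<psi> j (x i \<omega>)) \<le> B} \<in> events"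
  proof -
    have "{\<omega>\<in>space M. cmod (\<psi> j (x i \<omega>)) \<le> B} \<in> events" if "i < n" "j < m" for i j
      using measurable_compose[OF x meas, OF that] by measurable
    then have "{\<omega>\<in>space M. \<forall>i\<in>{..<n}. \<forall>j\<in>{..<m}. cmod (\<psi> j (x i \<omega>)) \<le> B} \<in> events"
      by (intro sets.sets_Collect_finite_All) auto
    then show ?thesis by (rule back_subst[of "\<lambda>A. A \<in> events"]) auto
  qed
  have badset: "bad a \<in> events" if I: "a \<in> I" for a
  proof -
    obtain q J where a: "a = (q, J)" "J \<in> \<Omega> q" using I by (cases a) (auto simp: I_def)
    have *: "(\<lambda>\<omega>. \<Sum>i<n. indicator (V q J) (x i \<omega>) :: real) \<in> borel_measurable M"
      using x V[OF a(2)]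
      by (intro borel_measurable_sum) (auto intro!: measurable_compose[OF x borel_measurable_indicator])
    have "real (card {i. i < n \<and> x i \<omega> \<in> V q J}) = (\<Sum>i<n. indicator (V q J) (x i \<omega>))" for \<omega>
      by (simp add: indicator_def sum.If_cases Int_def)
    then show ?thesis using * by (simp add: bad_def a)
  qed
  have badprob: "prob (bad a) \<le> exp (- real n / (64 * real Q * (2 ^ fst a / 2)\<^sup>2))" if a: "a \<in> I" for a
  proof -
    obtain q J where qJ: "a = (q, J)" "J \<in> \<Omega> q" "P q \<le> measure \<rho> (V q J)" using a by (cases a) (auto simp: I_def)
    have "measure \<rho> (V q J) = prob (x i -` V q J \<inter> space M)" if "i < n" for i
      using measure_distr[OF x[OF that] V[OF qJ(2)]] law[OF that] by simp
    then have "prob (bad a) \<le> exp (- real n * P q / 4)"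
      unfolding bad_def qJ(1) prod.case using qJ(3)
      by (intro count_lower_tail[OF indep V[OF qJ(2)]]) simp
    then show ?thesis by (simp add: P_def qJ(1) mult.assoc)
  qed
  have "prob (\<Union>a\<in>I. bad a) \<le> (\<Sum>a\<in>I. prob (bad a))"
    using finI badset by (intro finite_measure_subadditive_finite) auto
  also have "\<dots> \<le> (\<Sum>a\<in>I. exp (- real n / (64 * real Q * (2 ^ fst a / 2)\<^sup>2)))"
    using badprob by (rule sum_mono)
  also have "\<dots> \<le> (\<Sum>a\<in>(SIGMA q:{..<Q}. \<Omega> q). exp (- real n / (64 * real Q * (2 ^ fst a / 2)\<^sup>2)))"
    using fin\<Omega> by (intro sum_mono2) (auto simp: I_def)
  also have "\<dots> = (\<Sum>q<Q. (4 * real m) ^ k q * exp (- real n / (64 * real Q * (2 ^ q / 2)\<^sup>2)))"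
  proof -
    have "(\<Sum>a\<in>(SIGMA q:{..<Q}. \<Omega> q). exp (- real n / (64 * real Q * (2 ^ fst a / 2)\<^sup>2)))
        = (\<Sum>q<Q. \<Sum>J\<in>\<Omega> q. exp (- real n / (64 * real Q * (2 ^ q / 2)\<^sup>2)))"
      using fin\<Omega> by (subst sum.Sigma) (auto simp: case_prod_beta)
    then show ?thesis by (simp only: sum_constant card\<Omega>)
  qed
  finally have bad: "prob (\<Union>a\<in>I. bad a) < \<epsilon>" using \<epsilon> by linarith
  define G where "G = {\<omega>\<in>space M. \<forall>i<n. \<forall>j<m. cmod (\<psi> j (x i \<omega>)) \<le> B} - (\<Union>a\<in>I. bad a)"
  have badU: "(\<Union>a\<in>I. bad a) \<in> events" using finI badset by (rule sets.finite_UN)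
  have G: "G \<in> events" unfolding G_def using Bset badU by (rule sets.Diff)
  \<comment> \<open>Each sample point has law \<open>\<rho>\<close>, so the almost sure bound on the
    dictionary transfers to the finitely many sample points. Requiring it in \<open>G\<close> costs
    no probability.\<close>
  have "AE \<omega> in M. \<forall>i\<in>{..<n}. \<forall>j<m. cmod (\<psi> j (x i \<omega>)) \<le> B"
  proof (rule AE_finite_allI)
    fix i assume "i \<in> {..<n}"
    then have i: "i < n" by simp
    have "AE u in distr M \<rho> (x i). \<forall>j<m. cmod (\<psi> j u) \<le> B" unfolding law[OF i] by (rule B)
    then show "AE \<omega> in M. \<forall>j<m. cmod (\<psi> j (x i \<omega>)) \<le> B"
      by (rule AE_distrD[OF x[OF i]])
  qed simp
  then have "AE \<omega> in M. \<omega> \<in> G \<or> \<omega> \<in> (\<Union>a\<in>I. bad a)"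
    by (rule AE_mp) (rule AE_I2, auto simp: G_def)
  then have "1 \<le> prob (G \<union> (\<Union>a\<in>I. bad a))"
    using sets.Un[OF G badU] by (subst prob_eq_1[THEN iffD2]) simp_all
  also have "\<dots> \<le> prob G + prob (\<Union>a\<in>I. bad a)"
    using G badU by (rule measure_Un_le)
  finally have probG: "prob G > 1 - \<epsilon>" using bad by linarith
  have count: "real n / (64 * real Q * (2 ^ q / 2)\<^sup>2) < card {i. i < n \<and> x i \<omega> \<in> V q J}"
    if "\<omega> \<in> G" "q < Q" "J \<in> \<Omega> q" "P q \<le> measure \<rho> (V q J)" for \<omega> q J
  proof -
    have "\<omega> \<notin> bad (q, J)" "\<omega> \<in> space M" using that by (auto simp: G_def I_def)
    then show ?thesis by (simp add: bad_def P_def)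
  qed
  show ?thesis
  proof (intro bexI[OF _ G] conjI ballI allI impI)
    fix \<omega> assume "\<omega> \<in> G"
    then show "\<omega> \<in> space M" "\<And>i j. i < n \<Longrightarrow> j < m \<Longrightarrow> cmod (\<psi> j (x i \<omega>)) \<le> B" by (simp_all add: G_def)
  qed (rule probG, rule count[unfolded V_def \<Omega>_def P_def])
qed

section \<open>The LASSO error\<close>

text \<open>Minimality gives \<open>main\<close>, a quadratic inequality in the prediction error
  \<open>u\<close> that also contains the l1 error \<open>N1\<close>. Minimising over
  \<open>u\<close> bounds \<open>N1\<close>, discarding \<open>N1\<close> bounds \<open>u\<close>,
  and \<open>re\<close> combines both into a bound on \<open>N2\<close>.\<close>

lemma lasso_row_error:
  fixes k k' e :: "nat \<Rightarrow> complex" and a :: "nat \<Rightarrow> nat \<Rightarrow> complex" and lam \<eta> \<sigma> c1 c2 :: real and m n s :: nat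
  defines "h \<equiv> \<lambda>j. k' j - k j"
  defines "u \<equiv> L2_set (\<lambda>i. cmod (\<Sum>j<m. h j * a j i)) {..<n}"
    and "N2 \<equiv> L2_set (\<lambda>j. cmod (h j)) {..<m}"
  assumes s: "1 \<le> s" and c: "0 < c1" "c1 \<le> c2" and \<eta>: "0 < \<eta>"
    and lam: "c1 * \<eta> / sqrt s < lam" "lam < c2 * \<eta> / sqrt s"
    and re: "N2 \<le> (\<Sum>j<m. cmod (h j)) / (4 * sqrt s) + 8 * u"
    and e: "L2_set (\<lambda>i. cmod (e i)) {..<n} \<le> \<eta>"
    and opt: "(\<Sum>i<n. (cmod (e i - (\<Sum>j<m. h j * a j i)))\<^sup>2) + lam * (\<Sum>j<m. cmod (k' j))
       \<le> (\<Sum>i<n. (cmod (e i))\<^sup>2) + lam * (\<Sum>j<m. cmod (k j))"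
    and S: "S \<subseteq> {..<m}" "card S \<le> s" and \<sigma>: "(\<Sum>j\<in>{..<m} - S. cmod (k j)) \<le> \<sigma>"
  shows "N2 \<le> 9 * \<sigma> / sqrt s + ((1 + 8 * c2)\<^sup>2 / (2 * c1) + 8 * (2 * (1 + 8 * c2) + c2)) * \<eta>"
proof -
  define r where "r = sqrt s"
  define g where "g = (\<lambda>i. \<Sum>j<m. h j * a j i)"
  define N1 where "N1 = (\<Sum>j<m. cmod (h j))"
  define HS where "HS = (\<Sum>j\<in>S. cmod (h j))"
  define G where "G = 1 + 8 * c2"
  have r: "1 \<le> r" using s by (simp add: r_def)
  have finS: "finite S" using S(1) finite_subset by blast
  have u0: "0 \<le> u" by (simp add: u_def)
  have N1: "0 \<le> N1" by (simp add: N1_def sum_nonneg)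
  have \<sigma>0: "0 \<le> \<sigma>" using \<sigma> by (meson norm_ge_zero order_trans sum_nonneg)
  have "0 < c1 * \<eta> / sqrt s" using c \<eta> s by simp
  then have lam0: "0 < lam" using lam(1) by linarith
  have lamr: "lam * r \<le> c2 * \<eta>" "c1 * \<eta> \<le> lam * r"
    using lam r by (simp_all add: r_def field_simps)
  have usq: "u\<^sup>2 = (\<Sum>i<n. (cmod (g i))\<^sup>2)"
    by (simp add: u_def g_def L2_set_def sum_nonneg)

  have HS: "HS \<le> r * N2"
  proof -
    have "HS = (\<Sum>j\<in>S. \<bar>cmod (h j)\<bar> * \<bar>1 :: real\<bar>)" by (simp add: HS_def)
    also have "\<dots> \<le> L2_set (\<lambda>j. cmod (h j)) S * L2_set (\<lambda>_. 1) S" by (rule L2_set_mult_ineq)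
    also have "\<dots> \<le> N2 * r"
    proof (rule mult_mono)
      show "L2_set (\<lambda>j. cmod (h j)) S \<le> N2"
        using S(1) unfolding N2_def L2_set_def by (intro real_sqrt_le_mono sum_mono2) auto
      show "L2_set (\<lambda>_. 1) S \<le> r" using S(2) by (simp add: L2_set_constant r_def)
    qed (auto simp: N2_def)
    finally show ?thesis by (simp add: mult.commute)
  qed
  \<comment> \<open>The factor 4 in \<open>re\<close> matters here: \<open>2 * HS\<close> then
    consumes only half of \<open>N1\<close> in the comparison of the penalties.\<close>
  also have "r * N2 \<le> N1 / 4 + 8 * (r * u)"
  proof -
    have "r * (N1 / (4 * r) + 8 * u) = N1 / 4 + 8 * (r * u)" using r by (simp add: field_simps)
    then show ?thesis using mult_left_mono[OF re, of r] r by (simp add: N1_def r_def)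
  qed
  finally have HS': "HS \<le> N1 / 4 + 8 * (r * u)" .

  \<comment> \<open>On \<open>S\<close> the penalty drops by at most \<open>HS\<close>. Off
    \<open>S\<close> it grows by at least the error there minus twice the tail of
    \<open>k\<close>.\<close>
  have l1: "N1 - 2 * HS - 2 * \<sigma> \<le> (\<Sum>j<m. cmod (k' j)) - (\<Sum>j<m. cmod (k j))"
  proof -
    have split: "(\<Sum>j<m. f j) = (\<Sum>j\<in>{..<m} - S. f j) + (\<Sum>j\<in>S. f j)" for f :: "nat \<Rightarrow> real"
      using S(1) by (intro sum.subset_diff) auto
    have "(\<Sum>j\<in>S. cmod (k j) - cmod (h j)) \<le> (\<Sum>j\<in>S. cmod (k' j))"
      unfolding h_def by (intro sum_mono) (smt (verit) norm_triangle_ineq2 norm_minus_commute)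
    moreover have "(\<Sum>j\<in>{..<m} - S. cmod (h j) - cmod (k j)) \<le> (\<Sum>j\<in>{..<m} - S. cmod (k' j))"
      unfolding h_def by (intro sum_mono) (smt (verit) norm_triangle_ineq4)
    ultimately show ?thesis
      using \<sigma> unfolding N1_def HS_def split sum_subtractf by linarith
  qed

  have fit: "(\<Sum>i<n. (cmod (e i))\<^sup>2) + u\<^sup>2 - 2 * \<eta> * u \<le> (\<Sum>i<n. (cmod (e i - g i))\<^sup>2)"
  proof -
    have "(\<Sum>i<n. \<bar>cmod (e i)\<bar> * \<bar>cmod (g i)\<bar>) \<le> L2_set (\<lambda>i. cmod (e i)) {..<n} * L2_set (\<lambda>i. cmod (g i)) {..<n}"
      by (rule L2_set_mult_ineq)
    also have "\<dots> \<le> \<eta> * u"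
      unfolding u_def g_def using e by (intro mult_right_mono) auto
    finally have cs: "(\<Sum>i<n. cmod (e i) * cmod (g i)) \<le> \<eta> * u" by simp
    have "(\<Sum>i<n. (cmod (e i))\<^sup>2 + (cmod (g i))\<^sup>2 - 2 * (cmod (e i) * cmod (g i))) \<le> (\<Sum>i<n. (cmod (e i - g i))\<^sup>2)"
    proof (rule sum_mono)
      fix i
      have "\<bar>cmod (e i) - cmod (g i)\<bar>\<^sup>2 \<le> (cmod (e i - g i))\<^sup>2"
        using norm_triangle_ineq3[of "e i" "g i"] by (intro power_mono) auto
      then show "(cmod (e i))\<^sup>2 + (cmod (g i))\<^sup>2 - 2 * (cmod (e i) * cmod (g i)) \<le> (cmod (e i - g i))\<^sup>2"
        by (simp add: power2_diff)
    qed
    then show ?thesis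
      using cs unfolding usq by (simp add: sum.distrib sum_subtractf sum_distrib_left[symmetric])
  qed

  have "u\<^sup>2 - 2 * \<eta> * u + lam * (N1 / 2 - 16 * (r * u) - 2 * \<sigma>) \<le> 0"
  proof -
    have "lam * (N1 / 2 - 16 * (r * u) - 2 * \<sigma>) \<le> lam * ((\<Sum>j<m. cmod (k' j)) - (\<Sum>j<m. cmod (k j)))"
      using HS' l1 lam0 by (intro mult_left_mono) auto
    then show ?thesis using fit opt by (simp add: g_def right_diff_distrib)
  qed
  moreover have "lam * (16 * (r * u)) \<le> 16 * c2 * \<eta> * u"
    using mult_right_mono[OF lamr(1), of "16 * u"] u0 by (simp add: mult_ac)
  \<comment> \<open>In \<open>G = 1 + 8 * c2\<close> the 1 comes from the noise and
    \<open>8 * c2\<close> from the part of \<open>HS\<close> bounded by \<open>u\<close>.\<close>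
  ultimately have main: "u\<^sup>2 - 2 * G * \<eta> * u + lam * N1 / 2 \<le> 2 * (lam * \<sigma>)"
    by (simp add: G_def algebra_simps)

  \<comment> \<open>Completing the square bounds the quadratic in \<open>u\<close> below by
    \<open>- (G * \<eta>)\<^sup>2\<close>. The lower bound on \<open>lam\<close> then trades one
    factor \<open>\<eta>\<close> for \<open>lam * r / c1\<close>, so that \<open>lam\<close>
    cancels.\<close>
  have N1le: "N1 \<le> 4 * \<sigma> + 2 * G\<^sup>2 * \<eta> * r / c1"
  proof -
    have "- (G * \<eta>)\<^sup>2 \<le> u\<^sup>2 - 2 * G * \<eta> * u"
      using zero_le_power2[of "u - G * \<eta>"] by (simp add: power2_diff mult_ac)
    then have "lam * N1 \<le> 4 * (lam * \<sigma>) + 2 * G\<^sup>2 * \<eta> * \<eta>"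
      using main by (simp add: power_mult_distrib power2_eq_square[of \<eta>] mult.assoc)
    also have "2 * G\<^sup>2 * \<eta> * \<eta> \<le> lam * (2 * G\<^sup>2 * \<eta> * r / c1)"
      using mult_left_mono[OF lamr(2), of "2 * G\<^sup>2 * \<eta>"] c \<eta> by (simp add: field_simps)
    finally have "lam * N1 \<le> lam * (4 * \<sigma> + 2 * G\<^sup>2 * \<eta> * r / c1)"
      by (simp add: algebra_simps)
    then show ?thesis using lam0 by simp
  qed
  \<comment> \<open>Otherwise \<open>u * (u - 2 * G * \<eta>)\<close> exceeds the square of
    \<open>Y = c2 * \<eta> + \<sigma> / r\<close>. That square is at least twice the product of its
    two summands, hence at least \<open>2 * (lam * \<sigma>)\<close>, against
    \<open>main\<close>.\<close>
  have ule: "u \<le> 2 * G * \<eta> + (c2 * \<eta> + \<sigma> / r)"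
  proof (rule ccontr)
    define Y where "Y = c2 * \<eta> + \<sigma> / r"
    assume "\<not> ?thesis"
    then have Y: "Y < u - 2 * G * \<eta>" by (simp add: Y_def)
    have Y0: "0 \<le> Y" using c \<eta> \<sigma>0 r by (simp add: Y_def)
    have "Y \<le> u" using Y c \<eta> by (smt (verit) G_def mult_nonneg_nonneg)
    have "2 * (lam * \<sigma>) \<le> 2 * (c2 * \<eta>) * (\<sigma> / r)"
      using mult_right_mono[OF lamr(1), of "2 * \<sigma> / r"] \<sigma>0 r by (simp add: field_simps)
    also have "\<dots> \<le> Y * Y"
    proof -
      have "0 \<le> (c2 * \<eta>)\<^sup>2 + (\<sigma> / r)\<^sup>2" by simp
      then show ?thesis unfolding Y_def by (simp add: power2_eq_square algebra_simps)
    qed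
    also have "\<dots> < u * (u - 2 * G * \<eta>)"
    proof -
      have "0 < Y" using c \<eta> \<sigma>0 r by (simp add: Y_def add_pos_nonneg)
      then show ?thesis using Y \<open>Y \<le> u\<close> by (intro mult_le_less_imp_less) auto
    qed
    finally have "2 * (lam * \<sigma>) < u\<^sup>2 - 2 * G * \<eta> * u" by (simp add: power2_eq_square algebra_simps)
    moreover have "0 \<le> lam * N1" using lam0 N1 by simp
    ultimately show False using main by linarith
  qed
  \<comment> \<open>The coefficient 9 of \<open>\<sigma> / r\<close> is 1 from
    \<open>N1 / (4 * r)\<close> plus 8 from \<open>8 * u\<close>.\<close>
  have "N2 \<le> N1 / (4 * r) + 8 * u" using re by (simp add: N1_def r_def)
  also have "N1 / (4 * r) \<le> \<sigma> / r + G\<^sup>2 / (2 * c1) * \<eta>"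
    using divide_right_mono[OF N1le, of "4 * r"] r c by (simp add: field_simps)
  finally show ?thesis
    using ule by (simp add: G_def r_def[symmetric] algebra_simps)
qed

section \<open>Separation of the LASSO objective into rows\<close>

lemma frob_norm_power2:
  "(frob_norm A)\<^sup>2 = (\<Sum>i<dim_row A. \<Sum>j<dim_col A. (cmod (A $$ (i, j)))\<^sup>2)"
  by (simp add: frob_norm_def sum_nonneg)

definition lasso_row_objective ::
    "nat \<Rightarrow> nat \<Rightarrow> complex mat \<Rightarrow> complex mat \<Rightarrow> real \<Rightarrow> complex mat \<Rightarrow> nat \<Rightarrow> real" where
  "lasso_row_objective m n \<Phi> \<Psi> lam A i =
     (\<Sum>c<n. (cmod (\<Phi> $$ (i, c) - (\<Sum>j<m. A $$ (i, j) * \<Psi> $$ (j, c))))\<^sup>2) + lam * (\<Sum>j<m. cmod (A $$ (i, j)))"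

lemma mult_mat_index_sum:
  fixes A :: "complex mat"
  assumes "A \<in> carrier_mat l m" "P \<in> carrier_mat m n" "i < l" "c < n"
  shows "(A * P) $$ (i, c) = (\<Sum>j<m. A $$ (i, j) * P $$ (j, c))"
  using assms by (auto simp: scalar_prod_def atLeast0LessThan intro!: sum.cong)

lemma lasso_objective_rows:
  assumes "\<Phi> \<in> carrier_mat l n" "\<Psi> \<in> carrier_mat m n" "A \<in> carrier_mat l m"
  shows "(frob_norm (\<Phi> - A * \<Psi>))\<^sup>2 + lam * entry_l1_norm A = (\<Sum>i<l. lasso_row_objective m n \<Phi> \<Psi> lam A i)"
proof -
  have "(\<Phi> - A * \<Psi>) $$ (i, c) = \<Phi> $$ (i, c) - (\<Sum>j<m. A $$ (i, j) * \<Psi> $$ (j, c))" if "i < l" "c < n" for i c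
    using that assms mult_mat_index_sum[OF assms(3,2) that] by simp
  then have "(frob_norm (\<Phi> - A * \<Psi>))\<^sup>2 =
      (\<Sum>i<l. \<Sum>c<n. (cmod (\<Phi> $$ (i, c) - (\<Sum>j<m. A $$ (i, j) * \<Psi> $$ (j, c))))\<^sup>2)"
    using assms by (simp add: frob_norm_power2)
  moreover have "entry_l1_norm A = (\<Sum>i<l. \<Sum>j<m. cmod (A $$ (i, j)))"
    using assms(3) by (simp add: entry_l1_norm_def)
  ultimately show ?thesis
    by (simp add: lasso_row_objective_def sum.distrib sum_distrib_left)
qed

text \<open>The objective is a sum over rows, so the competitor that takes row \<open>i\<close> from
  \<open>K\<close> and all other rows from \<open>K'\<close> changes a single summand.\<close>

lemma lasso_solution_rows:
  assumes sol: "is_lasso_edmd_solution l m \<Phi> \<Psi> lam K'"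
    and carrier: "\<Phi> \<in> carrier_mat l n" "\<Psi> \<in> carrier_mat m n" "K \<in> carrier_mat l m" and i: "i < l"
  shows "lasso_row_objective m n \<Phi> \<Psi> lam K' i \<le> lasso_row_objective m n \<Phi> \<Psi> lam K i"
proof -
  have K': "K' \<in> carrier_mat l m" using sol by (simp add: is_lasso_edmd_solution_def is_arg_min_def)
  define A where "A = mat l m (\<lambda>(i', j). if i' = i then K $$ (i', j) else K' $$ (i', j))"
  have A: "A \<in> carrier_mat l m" by (simp add: A_def)
  have "(frob_norm (\<Phi> - K' * \<Psi>))\<^sup>2 + lam * entry_l1_norm K' \<le> (frob_norm (\<Phi> - A * \<Psi>))\<^sup>2 + lam * entry_l1_norm A"
    using sol A unfolding is_lasso_edmd_solution_def is_arg_min_def by (meson not_le)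
  then have le: "(\<Sum>i'<l. lasso_row_objective m n \<Phi> \<Psi> lam K' i') \<le> (\<Sum>i'<l. lasso_row_objective m n \<Phi> \<Psi> lam A i')"
    by (simp only: lasso_objective_rows[OF carrier(1,2) K'] lasso_objective_rows[OF carrier(1,2) A])
  have eq: "lasso_row_objective m n \<Phi> \<Psi> lam A i' =
      (if i' = i then lasso_row_objective m n \<Phi> \<Psi> lam K i else lasso_row_objective m n \<Phi> \<Psi> lam K' i')" if "i' < l" for i'
    using that by (simp add: lasso_row_objective_def A_def)
  have "(\<Sum>i'<l. lasso_row_objective m n \<Phi> \<Psi> lam A i') =
      lasso_row_objective m n \<Phi> \<Psi> lam K i + (\<Sum>i'\<in>{..<l} - {i}. lasso_row_objective m n \<Phi> \<Psi> lam K' i')"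
    using i by (subst sum.remove[of _ i]) (auto simp: eq intro!: sum.cong)
  moreover have "(\<Sum>i'<l. lasso_row_objective m n \<Phi> \<Psi> lam K' i') =
      lasso_row_objective m n \<Phi> \<Psi> lam K' i + (\<Sum>i'\<in>{..<l} - {i}. lasso_row_objective m n \<Phi> \<Psi> lam K' i')"
    using i by (intro sum.remove) auto
  ultimately show ?thesis using le by simp
qed

section \<open>Choice of the levels and of the net\<close>

text \<open>The constant is \<open>384 (4 K + 96)\<close>, where \<open>K = 1114112 = 4096 \<cdot> 16 \<cdot> 17\<close> is the factor in the length
  \<open>k\<close> of the means: \<open>384 = 64 \<cdot> 6\<close> comes from the Chernoff bound and the number \<open>Q\<close> of levels, \<open>4 K\<close> pays for
  the size of the net and \<open>96\<close> for the failure probability.\<close>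

lemma sampling_parameters:
  fixes B \<epsilon> :: real and s m n :: nat
  defines "R \<equiv> B * (4 * sqrt s)"
  assumes B: "1 \<le> B" and s: "1 \<le> s" "s \<le> m" and \<epsilon>: "0 < \<epsilon>" "\<epsilon> < 1"
    and n: "1711312896 * B\<^sup>2 * s * L_factor B m \<epsilon> s \<le> n"
  shows "\<exists>Q k. R < 2 ^ Q / 2 \<and>
    (\<forall>q<Q. 2 ^ q / 2 \<le> R \<and> 0 < k q \<and>
      8 * exp (- real (k q) * (2 ^ q / 2)\<^sup>2 / (4096 * R\<^sup>2)) \<le> 1 / (64 * real Q * (2 ^ q / 2)\<^sup>2)) \<and>
    (\<Sum>q<Q. (4 * real m) ^ k q * exp (- real n / (64 * real Q * (2 ^ q / 2)\<^sup>2))) < \<epsilon> \<and> 0 < n"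
proof -
  define b where "b = B\<^sup>2 * s"
  define a where "a = ln (2 * b)"
  define \<mu> where "\<mu> = ln (2 * real m)"
  define \<nu> where "\<nu> = ln (2 * inverse \<epsilon> * a)"
  have b: "1 \<le> b"
  proof -
    have "1 * 1 \<le> B\<^sup>2 * real s" using B s(1) by (intro mult_mono) auto
    then show ?thesis by (simp add: b_def)
  qed
  have R2: "R\<^sup>2 = 16 * b" by (simp add: R_def b_def power_mult_distrib)
  have R: "4 \<le> R"
  proof -
    have "1 * (4 * 1) \<le> B * (4 * sqrt s)" using B s(1) by (intro mult_mono) auto
    then show ?thesis by (simp add: R_def)
  qed
  have ln2: "2 / 3 \<le> ln (2 :: real)" using ln2_ge_two_thirds by simp
  have a2: "ln 2 \<le> a" using b by (simp add: a_def)
  have a: "2 / 3 \<le> a" using ln2 a2 by linarith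
  have ab: "a \<le> 2 * b" unfolding a_def using b ln_le_minus_one[of "2 * b"] by simp
  have \<mu>: "2 / 3 \<le> \<mu>"
  proof -
    have "ln 2 \<le> \<mu>" using s by (simp add: \<mu>_def)
    then show ?thesis using ln2 by linarith
  qed
  have ratio: "0 < \<epsilon> / (2 * a)" "\<epsilon> / (2 * a) \<le> 3 / 4" using a \<epsilon> by (auto simp: field_simps)
  have \<nu>: "exp (- \<nu>) = \<epsilon> / (2 * a)" using a \<epsilon> by (simp add: \<nu>_def exp_minus field_simps)
  have \<nu>0: "0 < \<nu>"
  proof (rule ccontr)
    assume "\<not> ?thesis"
    then have "1 \<le> exp (- \<nu>)" by simp
    then show False using ratio unfolding \<nu> by linarith
  qed
  have n': "1711312896 * b * (a * (a * \<mu> + \<nu>)) \<le> n"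
    using n by (simp add: L_factor_def Let_def a_def b_def \<mu>_def \<nu>_def mult_ac)
  have "0 < n"
  proof (rule ccontr)
    assume "\<not> ?thesis"
    moreover have "0 < 1711312896 * b * (a * (a * \<mu> + \<nu>))" using a b \<mu> \<nu>0 by (intro mult_pos_pos add_pos_pos) auto
    ultimately show False using n' by simp
  qed

  define Q where "Q = (LEAST Q. R < 2 ^ Q / 2)"
  have "\<exists>Q. 2 * R < 2 ^ Q" by (rule real_arch_pow) simp
  then have ex: "\<exists>Q. R < 2 ^ Q / 2" by (simp add: field_simps)
  have QR: "R < 2 ^ Q / 2" unfolding Q_def using ex by (rule LeastI_ex)
  have below: "2 ^ q / 2 \<le> R" if "q < Q" for q
    using not_less_Least[of q "\<lambda>Q. R < 2 ^ Q / 2"] that unfolding Q_def by simp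
  have "Q \<noteq> 0" using QR R by (intro notI) simp
  then obtain Q' where Q': "Q = Suc Q'" by (cases Q) auto
  \<comment> \<open>Minimality of \<open>Q\<close> gives \<open>2 ^ Q \<le> 4 * R\<close>, whose
    square is \<open>2 ^ 7 * (2 * b)\<close>. Taking logarithms, with \<open>ln 2 \<le> a\<close>,
    yields \<open>2 * (real Q * ln 2) \<le> 8 * a\<close>.\<close>
  have Qa: "real Q \<le> 6 * a"
  proof -
    have "(2 ^ Q) ^ 2 \<le> (4 * R) ^ 2" using below[of Q'] Q' by (intro power_mono) auto
    also have "\<dots> = 2 ^ 7 * (2 * b)" by (simp add: power_mult_distrib R2)
    finally have "ln ((2 ^ Q) ^ 2) \<le> ln (2 ^ 7 * (2 * b))"
      using b by (intro iffD2[OF ln_le_cancel_iff]) auto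
    also have "ln (2 ^ 7 * (2 * b)) = 7 * ln 2 + a"
    proof -
      have "ln ((2 :: real) ^ 7) = 7 * ln 2" by (subst ln_realpow) simp_all
      moreover have "ln ((2 :: real) ^ 7 * (2 * b)) = ln (2 ^ 7) + ln (2 * b)"
        using b by (intro ln_mult_pos) auto
      ultimately show ?thesis by (simp only: a_def)
    qed
    finally have "2 * (real Q * ln 2) \<le> 8 * a" using a2 by (simp add: ln_realpow)
    moreover have "real Q * (2 / 3) \<le> real Q * ln 2" using ln2 by (intro mult_left_mono) auto
    ultimately show ?thesis by linarith
  qed

  \<comment> \<open>Since \<open>R\<^sup>2 = 16 * b\<close>, this length makes the approximation
    exponent at least \<open>17 * a\<close>, and \<open>exp a = 2 * b\<close> turns it into the
    power \<open>(2 * b) ^ 17\<close>. As \<open>y q\<close> is at least 1, rounding up at most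
    doubles it.\<close>
  define y where "y = (\<lambda>q. 1114112 * a * b / (2 ^ q / 2 :: real)\<^sup>2)"
  define k where "k = (\<lambda>q. nat \<lceil>y q\<rceil>)"
  have u: "(2 ^ q / 2 :: real)\<^sup>2 \<le> 16 * b" "(0 :: real) < (2 ^ q / 2)\<^sup>2" if "q < Q" for q
    using power_mono[OF below[OF that], of 2] by (auto simp: R2)
  have y: "1 \<le> y q" if "q < Q" for q
  proof -
    have "16 * b \<le> 1114112 * a * b" using a b by (intro mult_right_mono) auto
    then have "(2 ^ q / 2 :: real)\<^sup>2 \<le> 1114112 * a * b" using u(1)[OF that] by linarith
    then show ?thesis unfolding y_def using u(2)[OF that] by (simp only: le_divide_eq_1_pos)
  qed
  have k: "y q \<le> real (k q)" "real (k q) \<le> 2 * y q" if "q < Q" for q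
    using y[OF that] by (simp_all add: k_def) linarith+
  have kpos: "0 < k q" if "q < Q" for q using k(1)[OF that] y[OF that] by simp

  have approx: "8 * exp (- real (k q) * (2 ^ q / 2)\<^sup>2 / (4096 * R\<^sup>2)) \<le> 1 / (64 * real Q * (2 ^ q / 2)\<^sup>2)"
    if q: "q < Q" for q
  proof -
    define t where "t = (2 ^ q / 2 :: real)\<^sup>2"
    have t: "0 < t" "t \<le> 16 * b" using u[OF q] by (auto simp: t_def)
    have "1114112 * a * b = y q * t" using t(1) by (simp add: y_def t_def[symmetric])
    also have "\<dots> \<le> real (k q) * t" using k(1)[OF q] t by (intro mult_right_mono) auto
    finally have "17 * a \<le> real (k q) * t / (4096 * R\<^sup>2)" using b by (simp add: R2 field_simps)
    then have "8 * exp (- real (k q) * t / (4096 * R\<^sup>2)) \<le> 8 * exp (- (17 * a))" by simp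
    also have "\<dots> = 8 / (2 * b) ^ 17"
    proof -
      have "exp (17 * a) = exp a ^ 17" using exp_of_nat_mult[of 17 a] by simp
      then show ?thesis using b by (simp add: exp_minus a_def field_simps)
    qed
    \<comment> \<open>The exponent 17 is large enough because \<open>2 ^ 17 = 131072\<close> exceeds
      512 * 6 * 2 * 16 = 98304, the product of the constants in the bounds on \<open>real Q\<close>
      and \<open>t\<close>.\<close>
    also have "\<dots> \<le> 1 / (64 * real Q * t)"
    proof -
      have "512 * (real Q * t) \<le> 512 * ((6 * (2 * b)) * (16 * b))"
        using Qa ab t b by (intro mult_left_mono mult_mono) auto
      also have "\<dots> \<le> 131072 * b\<^sup>2" by (simp add: power2_eq_square)
      also have "\<dots> \<le> 131072 * b ^ 17" using b by (intro mult_left_mono power_increasing) auto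
      also have "\<dots> = (2 * b) ^ 17" by (simp add: power_mult_distrib)
      finally have "8 / (2 * b) ^ 17 \<le> 8 / (512 * (real Q * t))"
        using t(1) b Q' by (intro divide_left_mono mult_pos_pos) auto
      then show ?thesis by (simp add: mult_ac)
    qed
    finally show ?thesis by (simp add: t_def)
  qed

  \<comment> \<open>The \<open>\<mu>\<close> part of the rate pays for the logarithm of the net
    size, where \<open>4 * real m \<le> (2 * real m)\<^sup>2\<close> gives \<open>2 * \<mu>\<close>
    per term. The \<open>\<nu>\<close> part leaves a margin of at least \<open>6 * \<nu>\<close>
    because \<open>b / t\<close> is at least \<open>1 / 16\<close>.\<close>
  have failure: "(4 * real m) ^ k q * exp (- real n / (64 * real Q * (2 ^ q / 2)\<^sup>2)) \<le> (\<epsilon> / (2 * a)) ^ 6"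
    if q: "q < Q" for q
  proof -
    define t where "t = (2 ^ q / 2 :: real)\<^sup>2"
    have t: "0 < t" "t \<le> 16 * b" using u[OF q] by (auto simp: t_def)
    have "ln (4 * real m) \<le> ln ((2 * real m) ^ 2)"
    proof (rule iffD2[OF ln_le_cancel_iff])
      have "real m * 1 \<le> real m * real m" using s by (intro mult_left_mono) auto
      then show "4 * real m \<le> (2 * real m)\<^sup>2" by (simp add: power2_eq_square)
    qed (use s in auto)
    also have "\<dots> = 2 * \<mu>" unfolding \<mu>_def by (subst ln_realpow) simp
    finally have "real (k q) * ln (4 * real m) \<le> 2 * y q * (2 * \<mu>)"
      using k(2)[OF q] y[OF q] s by (intro mult_mono) auto
    also have "\<dots> = 4456448 * (b / t) * (a * \<mu>)" by (simp add: y_def t_def[symmetric])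
    finally have entropy: "real (k q) * ln (4 * real m) \<le> 4456448 * (b / t) * (a * \<mu>)" .
    have "4456544 * (b / t) * (a * \<mu> + \<nu>) = 1711312896 * b * (a * (a * \<mu> + \<nu>)) / (64 * (6 * a) * t)"
      using a t by (simp add: field_simps)
    also have "\<dots> \<le> real n / (64 * (6 * a) * t)"
      using n' a t by (intro divide_right_mono) auto
    also have "\<dots> \<le> real n / (64 * real Q * t)"
      using Qa Q' t by (intro divide_left_mono mult_right_mono mult_left_mono mult_pos_pos) auto
    finally have rate: "4456544 * (b / t) * (a * \<mu> + \<nu>) \<le> real n / (64 * real Q * t)" .
    have "1 / 16 \<le> b / t" using t by (simp add: field_simps)
    then have "1 / 16 * \<nu> \<le> b / t * \<nu>" using \<nu>0 by (intro mult_right_mono) auto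
    moreover have "0 \<le> b / t * (a * \<mu>)" using a b t \<mu> by simp
    moreover have "4456544 * (b / t * (a * \<mu>)) + 4456544 * (b / t * \<nu>) \<le> real n / (64 * real Q * t)"
      using rate by (simp only: distrib_left mult.assoc)
    moreover have "real (k q) * ln (4 * real m) \<le> 4456448 * (b / t * (a * \<mu>))"
      using entropy by (simp only: mult.assoc)
    moreover have "X - Y \<le> - (6 * \<nu>)"
      if "1 / 16 * \<nu> \<le> z" "0 \<le> w" "4456544 * w + 4456544 * z \<le> Y" "X \<le> 4456448 * w" for X Y w z
      using that \<nu>0 by linarith
    ultimately have "real (k q) * ln (4 * real m) - real n / (64 * real Q * t) \<le> - (6 * \<nu>)"
      by blast
    then have "exp (real (k q) * ln (4 * real m) - real n / (64 * real Q * t)) \<le> exp (- (6 * \<nu>))"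
      by (simp only: exp_le_cancel_iff)
    moreover have "exp (- (6 * \<nu>)) = exp (- \<nu>) ^ 6" using exp_of_nat_mult[of 6 "- \<nu>"] by simp
    moreover have "exp (real (k q) * ln (4 * real m) - real n / (64 * real Q * t))
        = (4 * real m) ^ k q * exp (- real n / (64 * real Q * t))"
    proof -
      have "exp (real (k q) * ln (4 * real m)) = (4 * real m) ^ k q"
        using s by (subst exp_of_nat_mult) simp
      then show ?thesis by (simp only: diff_conv_add_uminus exp_add minus_divide_left)
    qed
    ultimately show ?thesis by (simp add: t_def \<nu>)
  qed
  \<comment> \<open>One of the six factors \<open>\<epsilon> / (2 * a)\<close> cancels the number of
    levels, at most \<open>6 * a\<close>, and leaves \<open>3 * \<epsilon>\<close>. The other five
    are at most \<open>3 / 4\<close> each and bring the 3 below 1.\<close>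
  have "(\<Sum>q<Q. (4 * real m) ^ k q * exp (- real n / (64 * real Q * (2 ^ q / 2)\<^sup>2))) \<le> (\<Sum>q<Q. (\<epsilon> / (2 * a)) ^ 6)"
    using failure by (intro sum_mono) auto
  also have "\<dots> \<le> 6 * a * (\<epsilon> / (2 * a)) ^ 6"
    using Qa ratio by (simp add: mult_right_mono)
  also have "\<dots> = 3 * \<epsilon> * (\<epsilon> / (2 * a)) ^ 5"
    using a by (simp add: field_simps eval_nat_numeral)
  also have "\<dots> \<le> 3 * \<epsilon> * (3 / 4) ^ 5"
    using ratio \<epsilon> by (intro mult_left_mono power_mono) auto
  also have "\<dots> < \<epsilon>" using \<epsilon> by (simp add: eval_nat_numeral)
  finally have "(\<Sum>q<Q. (4 * real m) ^ k q * exp (- real n / (64 * real Q * (2 ^ q / 2)\<^sup>2))) < \<epsilon>" .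
  then show ?thesis
    using QR below kpos approx \<open>0 < n\<close> by (intro exI[of _ Q] exI[of _ k]) auto
qed

section \<open>The lower bound for all coefficient vectors\<close>

text \<open>If the l1 term alone does not dominate, scaling \<open>h\<close> to unit 2-norm gives l1
  norm at most \<open>4 * sqrt s\<close>. Some sample point then carries a value of at least
  \<open>1 / 8\<close>, and a single coordinate bounds the 2-norm from below. The event comes from
  the net and so serves every \<open>h\<close>.\<close>

lemma (in prob_space) sampled_lower_bound:
  fixes \<psi> :: "nat \<Rightarrow> 'b \<Rightarrow> complex" and x :: "nat \<Rightarrow> 'a \<Rightarrow> 'b" and B \<epsilon> :: real
  assumes \<rho>: "prob_space \<rho>" and on: "L2_orthonormal \<rho> m \<psi>"
    and B: "1 \<le> B" "AE u in \<rho>. \<forall>j<m. cmod (\<psi> j u) \<le> B"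
    and indep: "indep_vars (\<lambda>_. \<rho>) x {..<n}" and law: "\<And>i. i < n \<Longrightarrow> distr M \<rho> (x i) = \<rho>"
    and s: "1 \<le> s" "s \<le> m" and \<epsilon>: "0 < \<epsilon>" "\<epsilon> < 1"
    and n: "1711312896 * B\<^sup>2 * s * L_factor B m \<epsilon> s \<le> n"
  shows "\<exists>G\<in>events. prob G > 1 - \<epsilon> \<and> (\<forall>\<omega>\<in>G. \<forall>h. L2_set (\<lambda>j. cmod (h j)) {..<m} \<le>
    (\<Sum>j<m. cmod (h j)) / (4 * sqrt s) + 8 * L2_set (\<lambda>i. cmod (\<Sum>j<m. h j * \<psi> j (x i \<omega>))) {..<n})"
proof -
  define r where "r = 4 * sqrt s"
  have r: "0 < r" using s by (simp add: r_def)
  from sampling_parameters[OF B(1) s \<epsilon> n, folded r_def] obtain Q k where Q: "B * r < 2 ^ Q / 2"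
    and Qk: "\<forall>q<Q. 2 ^ q / 2 \<le> B * r \<and> 0 < k q \<and>
      8 * exp (- real (k q) * (2 ^ q / 2)\<^sup>2 / (4096 * (B * r)\<^sup>2)) \<le> 1 / (64 * real Q * (2 ^ q / 2)\<^sup>2)"
    and fail: "(\<Sum>q<Q. (4 * real m) ^ k q * exp (- real n / (64 * real Q * (2 ^ q / 2)\<^sup>2))) < \<epsilon>"
    and n0: "0 < n"
    by (elim exE conjE) (rule that)
  have meas: "\<psi> j \<in> borel_measurable \<rho>" if "j < m" for j
    using on that by (simp add: L2_orthonormal_def sq_integrable_def)
  have x: "x i \<in> M \<rightarrow>\<^sub>M \<rho>" if "i < n" for i using indep that by (simp add: indep_vars_def)
  obtain G where G: "G \<in> events" "prob G > 1 - \<epsilon>"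
    and good: "\<forall>\<omega>\<in>G. \<omega> \<in> space M \<and> (\<forall>i<n. \<forall>j<m. cmod (\<psi> j (x i \<omega>)) \<le> B) \<and>
    (\<forall>q<Q. \<forall>J\<in>{..<k q} \<rightarrow>\<^sub>E ({..<m} \<times> {..<4}).
      1 / (16 * real Q * (2 ^ q / 2)\<^sup>2) \<le> measure \<rho> {u\<in>space \<rho>. 2 ^ q / 4 \<le> cmod (phase_mean r \<psi> (k q) J u)} \<longrightarrow>
      real n / (64 * real Q * (2 ^ q / 2)\<^sup>2) <
        card {i. i < n \<and> x i \<omega> \<in> {u\<in>space \<rho>. 2 ^ q / 4 \<le> cmod (phase_mean r \<psi> (k q) J u)}})"
    by (rule bexE[OF sampling_event[OF \<rho> meas B(2) indep law fail, of r]])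
      (assumption, assumption, elim conjE, rule that)
  have "L2_set (\<lambda>j. cmod (h j)) {..<m} \<le>
      (\<Sum>j<m. cmod (h j)) / r + 8 * L2_set (\<lambda>i. cmod (\<Sum>j<m. h j * \<psi> j (x i \<omega>))) {..<n}"
    if \<omega>: "\<omega> \<in> G" for \<omega> h
  proof (cases "L2_set (\<lambda>j. cmod (h j)) {..<m} \<le> (\<Sum>j<m. cmod (h j)) / r")
    case True
    then show ?thesis using L2_set_nonneg[of "\<lambda>i. cmod (\<Sum>j<m. h j * \<psi> j (x i \<omega>))" "{..<n}"] by linarith
  next
    case False
    define N where "N = L2_set (\<lambda>j. cmod (h j)) {..<m}"
    have "0 \<le> (\<Sum>j<m. cmod (h j)) / r" using r by (simp add: sum_nonneg)
    then have N: "0 < N" using False by (simp add: N_def)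
    define g where "g = (\<lambda>j. h j / of_real N)"
    have g1: "(\<Sum>j<m. cmod (g j)) \<le> r"
      using False N r by (simp add: g_def norm_divide sum_divide_distrib[symmetric] N_def[symmetric] field_simps)
    have g2: "(\<Sum>j<m. (cmod (g j))\<^sup>2) = 1"
    proof -
      have "(\<Sum>j<m. (cmod (g j))\<^sup>2) = (\<Sum>j<m. (cmod (h j))\<^sup>2) / N\<^sup>2"
        by (simp add: g_def norm_divide power_divide sum_divide_distrib)
      also have "(\<Sum>j<m. (cmod (h j))\<^sup>2) = N\<^sup>2" by (simp add: N_def L2_set_def sum_nonneg)
      finally show ?thesis using N by simp
    qed
    note good\<omega> = good[THEN bspec, OF \<omega>]
    have "\<exists>i<n. 1 / 8 \<le> cmod (\<Sum>j<m. g j * \<psi> j (x i \<omega>))"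
    proof (rule exists_large_value[where k = k, OF \<rho> on B(2) _ _ _ r g1 g2 n0 Q])
      show "x i \<omega> \<in> space \<rho>" if "i < n" for i
        using measurable_space[OF x[OF that]] good\<omega> by blast
      show "cmod (\<psi> j (x i \<omega>)) \<le> B" if "i < n" "j < m" for i j
        using good\<omega> that by blast
      show "0 < B" using B(1) by simp
    qed (use Qk in blast, use Qk in blast, use Qk in blast, rule good\<omega>[THEN conjunct2, THEN conjunct2, rule_format])
    then obtain i where i: "i < n" "1 / 8 \<le> cmod (\<Sum>j<m. g j * \<psi> j (x i \<omega>))" by blast
    have "(\<Sum>j<m. g j * \<psi> j (x i \<omega>)) = (\<Sum>j<m. h j * \<psi> j (x i \<omega>)) / of_real N"
      by (simp add: g_def sum_divide_distrib)
    then have "1 / 8 \<le> cmod (\<Sum>j<m. h j * \<psi> j (x i \<omega>)) / N"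
      using i(2) N by (simp only: norm_divide norm_of_real abs_of_pos)
    then have "N \<le> 8 * cmod (\<Sum>j<m. h j * \<psi> j (x i \<omega>))"
      using N by (simp add: field_simps)
    also have "cmod (\<Sum>j<m. h j * \<psi> j (x i \<omega>)) \<le> L2_set (\<lambda>i. cmod (\<Sum>j<m. h j * \<psi> j (x i \<omega>))) {..<n}"
      using i(1) by (intro member_le_L2_set) auto
    finally show ?thesis using \<open>0 \<le> (\<Sum>j<m. cmod (h j)) / r\<close> by (simp add: N_def)
  qed
  then show ?thesis using G unfolding r_def by blast
qed

section \<open>From the row estimates to the matrix estimate\<close>

text \<open>Off the support \<open>S\<close> of an \<open>s\<close>-sparse \<open>z\<close>, the
  vectors \<open>c - z\<close> and \<open>c\<close> agree, so the l1 distance is at least the tail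
  of \<open>c\<close> off \<open>S\<close>. A bound by all such tails thus passes to the infimum
  without a minimiser being exhibited.\<close>

lemma best_approx_error_greatest:
  assumes "\<And>S. S \<subseteq> {..<dim_vec c} \<Longrightarrow> card S \<le> s \<Longrightarrow> y \<le> (\<Sum>j\<in>{..<dim_vec c} - S. cmod (vec_index c j))"
  shows "y \<le> best_approx_error s c"
  unfolding best_approx_error_def
proof (rule cINF_greatest)
  \<comment> \<open>The zero vector keeps the index set nonempty; an infimum over the empty set of
    reals would be a mere default value.\<close>
  have "0\<^sub>v (dim_vec c) \<in> {z \<in> carrier_vec (dim_vec c). nnz z \<le> s}"
  proof -
    have "nnz (0\<^sub>v (dim_vec c)) = 0" unfolding nnz_def by (rule card_eq_0_iff[THEN iffD2]) auto
    then show ?thesis by simp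
  qed
  then show "{z \<in> carrier_vec (dim_vec c). nnz z \<le> s} \<noteq> {}" by blast
next
  fix z assume z: "z \<in> {z \<in> carrier_vec (dim_vec c). nnz z \<le> s}"
  define S where "S = {i. i < dim_vec z \<and> vec_index z i \<noteq> 0}"
  have dim: "dim_vec z = dim_vec c" using z by auto
  have "y \<le> (\<Sum>j\<in>{..<dim_vec c} - S. cmod (vec_index c j))"
    using z dim by (intro assms) (auto simp: S_def nnz_def)
  also have "\<dots> = (\<Sum>j\<in>{..<dim_vec c} - S. cmod (vec_index (c - z) j))"
    using dim by (intro sum.cong) (auto simp: S_def)
  also have "\<dots> \<le> (\<Sum>j<dim_vec c. cmod (vec_index (c - z) j))"
    by (intro sum_mono2) auto
  also have "\<dots> = vec_l1_norm (c - z)" using dim by (simp add: vec_l1_norm_def)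
  finally show "y \<le> vec_l1_norm (c - z)" .
qed

lemma cmod_col_mat_adjoint:
  assumes "K \<in> carrier_mat l m" "i < l" "j < m"
  shows "cmod (vec_index (Matrix.col (mat_adjoint K) i) j) = cmod (K $$ (i, j))"
  using assms by (simp add: mat_adjoint_def mat_of_rows_def conjugate_complex_def)

lemma dim_col_mat_adjoint:
  "K \<in> carrier_mat l m \<Longrightarrow> dim_vec (Matrix.col (mat_adjoint K) i) = m"
  by (simp add: mat_adjoint_def)

lemma lasso_edmd_error:
  fixes K K' E \<Phi> \<Psi> :: "complex mat" and lam \<eta> c1 c2 :: real and s l m n :: nat
  assumes carrier: "K \<in> carrier_mat l m" "\<Psi> \<in> carrier_mat m n" "E \<in> carrier_mat l n"
    and \<Phi>: "\<Phi> = K * \<Psi> + E" and s: "1 \<le> s" and c: "0 < c1" "c1 \<le> c2"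
    and \<eta>: "0 < \<eta>" "frob_norm E \<le> \<eta>" and lam: "c1 * \<eta> / sqrt s < lam" "lam < c2 * \<eta> / sqrt s"
    and sol: "is_lasso_edmd_solution l m \<Phi> \<Psi> lam K'"
    and re: "\<And>h. L2_set (\<lambda>j. cmod (h j)) {..<m} \<le>
      (\<Sum>j<m. cmod (h j)) / (4 * sqrt s) + 8 * L2_set (\<lambda>c. cmod (\<Sum>j<m. h j * \<Psi> $$ (j, c))) {..<n}"
  defines "D \<equiv> (1 + 8 * c2)\<^sup>2 / (2 * c1) + 8 * (2 * (1 + 8 * c2) + c2)"
  shows "(frob_norm (K' - K))\<^sup>2 \<le>
    (\<Sum>i<l. (9 * best_approx_error s (Matrix.col (mat_adjoint K) i) / sqrt s + D * \<eta>)\<^sup>2)"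
proof -
  have K': "K' \<in> carrier_mat l m" using sol by (simp add: is_lasso_edmd_solution_def is_arg_min_def)
  have \<Phi>carrier: "\<Phi> \<in> carrier_mat l n" using carrier \<Phi> by simp
  have \<Phi>entry: "\<Phi> $$ (i, c) = (\<Sum>j<m. K $$ (i, j) * \<Psi> $$ (j, c)) + E $$ (i, c)" if "i < l" "c < n" for i c
    using that carrier mult_mat_index_sum[OF carrier(1,2) that] by (simp add: \<Phi>)
  define N where "N = (\<lambda>i. L2_set (\<lambda>j. cmod (K' $$ (i, j) - K $$ (i, j))) {..<m})"
  have row: "N i \<le> 9 * best_approx_error s (Matrix.col (mat_adjoint K) i) / sqrt s + D * \<eta>"
    if i: "i < l" for i
  proof -
    have noise: "L2_set (\<lambda>c. cmod (E $$ (i, c))) {..<n} \<le> \<eta>"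
    proof -
      have "(\<Sum>c<n. (cmod (E $$ (i, c)))\<^sup>2) \<le> (\<Sum>i<l. \<Sum>c<n. (cmod (E $$ (i, c)))\<^sup>2)"
        using i by (intro member_le_sum[of i "{..<l}" "\<lambda>i. \<Sum>c<n. (cmod (E $$ (i, c)))\<^sup>2"]) (auto intro: sum_nonneg)
      then have "L2_set (\<lambda>c. cmod (E $$ (i, c))) {..<n} \<le> frob_norm E"
        using carrier(3) by (simp add: L2_set_def frob_norm_def)
      then show ?thesis using \<eta>(2) by linarith
    qed
    have resid: "\<Phi> $$ (i, c) - (\<Sum>j<m. K' $$ (i, j) * \<Psi> $$ (j, c))
        = E $$ (i, c) - (\<Sum>j<m. (K' $$ (i, j) - K $$ (i, j)) * \<Psi> $$ (j, c))" if "c < n" for c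
      by (simp add: \<Phi>entry[OF i that] left_diff_distrib sum_subtractf)
    have resid0: "\<Phi> $$ (i, c) - (\<Sum>j<m. K $$ (i, j) * \<Psi> $$ (j, c)) = E $$ (i, c)" if "c < n" for c
      by (simp add: \<Phi>entry[OF i that])
    have opt: "(\<Sum>c<n. (cmod (E $$ (i, c) - (\<Sum>j<m. (K' $$ (i, j) - K $$ (i, j)) * \<Psi> $$ (j, c))))\<^sup>2)
          + lam * (\<Sum>j<m. cmod (K' $$ (i, j)))
        \<le> (\<Sum>c<n. (cmod (E $$ (i, c)))\<^sup>2) + lam * (\<Sum>j<m. cmod (K $$ (i, j)))"
      using lasso_solution_rows[OF sol \<Phi>carrier carrier(2,1) i]
      by (simp add: lasso_row_objective_def resid resid0)
    \<comment> \<open>The row estimate is solved for the tail of the coefficients, the form in which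
      it passes to the best approximation error. Every row may use the full \<open>\<eta>\<close>,
      since its noise is part of \<open>E\<close>.\<close>
    have "(N i - D * \<eta>) * sqrt s / 9 \<le> best_approx_error s (Matrix.col (mat_adjoint K) i)"
    proof (rule best_approx_error_greatest, unfold dim_col_mat_adjoint[OF carrier(1)])
      fix S assume S: "S \<subseteq> {..<m}" "card S \<le> s"
      have "N i \<le> 9 * (\<Sum>j\<in>{..<m} - S. cmod (K $$ (i, j))) / sqrt s + D * \<eta>"
        unfolding N_def D_def
        by (rule lasso_row_error[OF s c \<eta>(1) lam re noise opt S order_refl])
      then have "(N i - D * \<eta>) * sqrt s / 9 \<le> (\<Sum>j\<in>{..<m} - S. cmod (K $$ (i, j)))"
        using s by (simp add: field_simps)
      then show "(N i - D * \<eta>) * sqrt s / 9 \<le> (\<Sum>j\<in>{..<m} - S. cmod (vec_index (Matrix.col (mat_adjoint K) i) j))"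
        using cmod_col_mat_adjoint[OF carrier(1) i] by simp
    qed
    then show ?thesis using s by (simp add: field_simps)
  qed
  have "(frob_norm (K' - K))\<^sup>2 = (\<Sum>i<l. (N i)\<^sup>2)"
    using carrier(1) K' by (simp add: frob_norm_power2 N_def L2_set_def sum_nonneg)
  also have "\<dots> \<le> (\<Sum>i<l. (9 * best_approx_error s (Matrix.col (mat_adjoint K) i) / sqrt s + D * \<eta>)\<^sup>2)"
    using row by (intro sum_mono power_mono) (auto simp: N_def)
  finally show ?thesis .
qed

section \<open>Assembly for Koopman data\<close>

text \<open>This makes the sample size bound monotone in its factor
  \<open>1 / \<delta>\<^sup>2\<close>. The inner logarithm is nonnegative because its argument is at
  least \<open>4 / 3\<close>.\<close>

lemma L_factor_nonneg:
  assumes "1 \<le> B" "1 \<le> s" "1 \<le> m" "0 < \<epsilon>" "\<epsilon> < 1"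
  shows "0 \<le> L_factor B m \<epsilon> s"
proof -
  have "1 * 1 \<le> B\<^sup>2 * real s" using assms by (intro mult_mono) auto
  then have "ln 2 \<le> ln (2 * B\<^sup>2 * real s)" by (intro iffD2[OF ln_le_cancel_iff]) linarith+
  then have a: "2 / 3 \<le> ln (2 * B\<^sup>2 * real s)" using ln2_ge_two_thirds by linarith
  have "1 * (2 / 3) \<le> inverse \<epsilon> * ln (2 * B\<^sup>2 * real s)"
    using a assms by (intro mult_mono) (auto simp: one_le_inverse)
  then have "0 \<le> ln (2 * inverse \<epsilon> * ln (2 * B\<^sup>2 * real s))" by (intro ln_ge_zero) simp
  moreover have "0 \<le> ln (2 * real m)" using assms by simp
  ultimately show ?thesis using a unfolding L_factor_def Let_def
    by (intro mult_nonneg_nonneg add_nonneg_nonneg) auto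
qed

text \<open>The essential suprema become one almost sure bound for all of the finitely many
  \<open>\<psi> j\<close>, and independence and law carry over from \<open>S\<close> to
  \<open>\<rho>\<close> because both have the same measurable sets.\<close>

lemma koopman_data_sampled_lower_bound:
  fixes S \<rho> :: "'a measure" and M :: "'w measure"
  assumes \<rho>: "\<rho> \<in> space (prob_algebra S)" and M: "prob_space M"
    and data: "koopman_data S \<rho> \<kappa> \<tau> M n x y"
    and on: "L2_orthonormal \<rho> m \<psi>"
    and B: "1 \<le> B" "\<forall>j<m. esssup \<rho> (\<lambda>u. ereal (cmod (\<psi> j u))) \<le> ereal B"
    and s: "1 \<le> s" "s \<le> m" and \<epsilon>: "0 < \<epsilon>" "\<epsilon> < 1"
    and n: "1711312896 * B\<^sup>2 * s * L_factor B m \<epsilon> s \<le> n"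
  shows "\<exists>G\<in>sets M. measure M G > 1 - \<epsilon> \<and> (\<forall>\<omega>\<in>G. \<forall>h. L2_set (\<lambda>j. cmod (h j)) {..<m} \<le>
    (\<Sum>j<m. cmod (h j)) / (4 * sqrt s) + 8 * L2_set (\<lambda>i. cmod (\<Sum>j<m. h j * \<psi> j (x i \<omega>))) {..<n})"
proof -
  have sets [simp]: "sets \<rho> = sets S" and prob: "prob_space \<rho>" using \<rho> by (auto simp: space_prob_algebra)
  have "AE u in \<rho>. \<forall>j\<in>{..<m}. cmod (\<psi> j u) \<le> B"
  proof (rule AE_finite_allI)
    fix j assume "j \<in> {..<m}"
    then have "esssup \<rho> (\<lambda>u. ereal (cmod (\<psi> j u))) \<le> ereal B" using B(2) by simp
    then show "AE u in \<rho>. cmod (\<psi> j u) \<le> B"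
      using esssup_AE[where f = "\<lambda>u. ereal (cmod (\<psi> j u))" and M = \<rho>]
      by (auto elim!: eventually_mono dest: order_trans)
  qed simp
  then have bound: "AE u in \<rho>. \<forall>j<m. cmod (\<psi> j u) \<le> B" by (simp add: Ball_def)
  have "prob_space.indep_vars M (\<lambda>_. S) x {..<n}" using data by (simp add: koopman_data_def)
  then have indep: "prob_space.indep_vars M (\<lambda>_. \<rho>) x {..<n}"
    unfolding prob_space.indep_vars_def2[OF M] by (simp add: measurable_cong_sets[OF refl sets])
  have law: "distr M \<rho> (x i) = \<rho>" if "i < n" for i
  proof -
    have "distr M \<rho> (x i) = distr M S (x i)" by (rule distr_cong) auto
    then show ?thesis using data that by (simp add: koopman_data_def)
  qed
  show ?thesis by (rule prob_space.sampled_lower_bound[OF M prob on B(1) bound indep law s \<epsilon> n])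
qed

text \<open>The error constants are fixed before the dimensions, the dynamics and the sample. One
  event \<open>A\<close> serves every noise level, every \<open>lam\<close> and every minimiser,
  because it only controls the values of \<open>\<psi>\<close> at the sampled states.\<close>

theorem theorem3:
  "\<exists>C>0. \<forall>\<delta> c1 c2 :: real. 0 < \<delta> \<and> \<delta> \<le> sqrt 2 - 1 \<and> 0 < c1 \<and> c1 \<le> c2 \<longrightarrow>
    (\<exists>C1>0. \<exists>D1>0.
      \<forall>(d :: nat) (X :: point set) (\<rho> :: point measure) (\<kappa> :: real \<Rightarrow> point \<Rightarrow> point measure)
        (\<tau> :: real) (m :: nat) (\<psi> :: nat \<Rightarrow> point \<Rightarrow> complex) (l :: nat)
        (\<phi> :: nat \<Rightarrow> point \<Rightarrow> complex) (K :: complex mat) (s :: nat) (\<epsilon> :: real) (B :: real)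
        (n :: nat) (M :: sample measure)
        (x :: nat \<Rightarrow> sample \<Rightarrow> point) (y :: nat \<Rightarrow> sample \<Rightarrow> point).
        X \<subseteq> space (\<Pi>\<^sub>M k\<in>{..<d}. (borel :: real measure)) \<longrightarrow>
        \<rho> \<in> space (prob_algebra (state_space d X)) \<longrightarrow>
        0 < \<tau> \<longrightarrow>
        \<kappa> \<tau> \<in> state_space d X \<rightarrow>\<^sub>M prob_algebra (state_space d X) \<longrightarrow>
        1 \<le> s \<and> s \<le> m \<longrightarrow>
        0 < \<epsilon> \<and> \<epsilon> < 1 \<longrightarrow>
        L2_orthonormal \<rho> m \<psi> \<longrightarrow>
        1 \<le> B \<longrightarrow>
        (\<forall>j<m. esssup \<rho> (\<lambda>u. ereal (cmod (\<psi> j u))) \<le> ereal B) \<longrightarrow>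
        (\<forall>j<l. sq_integrable \<rho> (\<phi> j)) \<longrightarrow>
        is_koopman_matrix \<rho> \<kappa> \<tau> m \<psi> l \<phi> K \<longrightarrow>
        real n \<ge> C * (1 / \<delta>\<^sup>2) * B\<^sup>2 * real s * L_factor B m \<epsilon> s \<longrightarrow>
        prob_space M \<longrightarrow>
        koopman_data (state_space d X) \<rho> \<kappa> \<tau> M n x y \<longrightarrow>
        (\<exists>A\<in>sets M. measure M A > 1 - \<epsilon> \<and>
          (\<forall>\<omega>\<in>A. \<forall>(\<eta> :: real) (lam :: real) (E :: complex mat) (Ksharp :: complex mat).
            let \<Psi> = data_matrix m n \<psi> (\<lambda>i. x i \<omega>);
                \<Phi> = data_matrix l n \<phi> (\<lambda>i. y i \<omega>)
            in E \<in> carrier_mat l n \<longrightarrow> \<Phi> = K * \<Psi> + E \<longrightarrow>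
               0 < \<eta> \<longrightarrow> frob_norm E \<le> \<eta> \<longrightarrow>
               lam \<in> {c1 * \<eta> / sqrt (real s) <..< c2 * \<eta> / sqrt (real s)} \<longrightarrow>
               is_lasso_edmd_solution l m \<Phi> \<Psi> lam Ksharp \<longrightarrow>
               (frob_norm (Ksharp - K))\<^sup>2 \<le>
                 (\<Sum>i<l. (C1 * best_approx_error s (Matrix.col (mat_adjoint K) i) / sqrt (real s)
                         + D1 * \<eta>)\<^sup>2))))"
proof (rule exI[of _ "1711312896 :: real"], intro conjI allI impI, goal_cases)
  case 1
  show ?case by simp
next
  case (2 \<delta> c1 c2)
  define D where "D = (1 + 8 * c2)\<^sup>2 / (2 * c1) + 8 * (2 * (1 + 8 * c2) + c2)"
  have c: "0 < c1" "c1 \<le> c2" and \<delta>: "0 < \<delta>" "\<delta> \<le> sqrt 2 - 1" using 2 by auto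
  have D: "0 < D" using c unfolding D_def by (intro add_nonneg_pos) auto
  \<comment> \<open>Hence \<open>\<delta>\<close> is at most 1 and
    \<open>1 / \<delta>\<^sup>2\<close> at least 1, so the assumed sample size reaches the one that
    the lower bound asks for.\<close>
  have "sqrt 2 \<le> (2 :: real)" by (rule real_le_lsqrt) auto
  then have "\<delta>\<^sup>2 \<le> 1" using \<delta> by (intro power_le_one) auto
  then have \<delta>1: "1 \<le> 1 / \<delta>\<^sup>2" using \<delta>(1) by simp
  show ?case
  proof (rule exI[of _ "9 :: real"], intro exI[of _ D] conjI allI impI, goal_cases)
    case 1
    show ?case by simp
  next
    case 2
    show ?case by (rule D)
  next
    case (3 d X \<rho> \<kappa> \<tau> m \<psi> l \<phi> K s \<epsilon> B n M x y)
    have s: "1 \<le> s" "s \<le> m" and \<epsilon>: "0 < \<epsilon>" "\<epsilon> < 1" using 3 by auto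
    have "1711312896 * B\<^sup>2 * real s * L_factor B m \<epsilon> s
        \<le> (1 / \<delta>\<^sup>2) * (1711312896 * B\<^sup>2 * real s * L_factor B m \<epsilon> s)"
      using L_factor_nonneg[of B s m \<epsilon>] 3(8) s \<epsilon> \<delta>1
      by (intro mult_right_mono[of 1 "1 / \<delta>\<^sup>2", simplified mult_1]) auto
    then have "1711312896 * B\<^sup>2 * real s * L_factor B m \<epsilon> s \<le> real n"
      using 3(12) by (simp add: mult_ac)
    then obtain A where A: "A \<in> sets M" "measure M A > 1 - \<epsilon>"
      and re: "\<And>\<omega> h. \<omega> \<in> A \<Longrightarrow> L2_set (\<lambda>j. cmod (h j)) {..<m} \<le>
        (\<Sum>j<m. cmod (h j)) / (4 * sqrt s) + 8 * L2_set (\<lambda>i. cmod (\<Sum>j<m. h j * \<psi> j (x i \<omega>))) {..<n}"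
      using koopman_data_sampled_lower_bound[OF 3(2) 3(13) 3(14) 3(7) 3(8) 3(9) s \<epsilon>] by blast
    have K: "K \<in> carrier_mat l m" using 3(11) by (simp add: is_koopman_matrix_def)
    show ?case
    proof (intro bexI[OF _ A(1)] conjI ballI allI, goal_cases)
      case 1
      show ?case by (rule A(2))
    next
      case (2 \<omega> \<eta> lam E Ksharp)
      have "L2_set (\<lambda>j. cmod (h j)) {..<m} \<le> (\<Sum>j<m. cmod (h j)) / (4 * sqrt s) +
          8 * L2_set (\<lambda>c. cmod (\<Sum>j<m. h j * data_matrix m n \<psi> (\<lambda>i. x i \<omega>) $$ (j, c))) {..<n}" for h
        using re[OF 2, of h] by (simp add: data_matrix_def cong: L2_set_cong_simp)
      then show ?case
        unfolding Let_def D_def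
        by (intro impI lasso_edmd_error[OF K _ _ _ s(1) c]) (auto simp: data_matrix_def)
    qed
  qed
qed

end
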